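(* Let $m,n\ge 1$, $p\ge 0$ and $s\ge 2$ be integers, and let $\mathcal{Q}=(q_1,\ldots,q_p)\colon I=[0,1]\to \operatorname{Conf}(\mathbb{R}^m,p)$ be a continuous map. Then the evaluation map $$\pi_{n,s}(\mathcal{Q})\colon E_n(\mathcal{Q})\to B_{n,s}(\mathcal{Q}),\qquad \gamma\mapsto\left(\gamma(0),\gamma\left(\tfrac{1}{s-1}\right),\ldots,\gamma\left(\tfrac{s-2}{s-1}\right),\gamma(1)\right)$$ is a fibration, whose fibrewise homeomorphism type is independent of $\mathcal{Q}$; that is, for any two continuous maps $\mathcal{Q},\mathcal{Q}'\colon I\to\operatorname{Conf}(\mathbb{R}^m,p)$ there are homeomorphisms $E_n(\mathcal{Q})\to E_n(\mathcal{Q}')$ and $B_{n,s}(\mathcal{Q})\to B_{n,s}(\mathcal{Q}')$ which commute with $\pi_{n,s}(\mathcal{Q})$ and $\pi_{n,s}(\mathcal{Q}')$. Moreover, $$\operatorname{secat}\left(\pi_{n,s}(\mathcal{Q})\right)=\operatorname{TC}_s\left(\operatorname{Conf}(\mathbb{R}^m-Q_p,n)\right),$$ where $Q_p=\{q_1(0),\ldots,q_p(0)\}\subset\mathbb{R}^m$.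
   Context: For a space $X$, $\operatorname{Conf}(X,k)$ is the space of ordered $k$-tuples of pairwise distinct points of $X$, topologised as a subspace of $X^k$ (a single point if $k=0$). For a $k$-tuple $a=(a_1,\ldots,a_k)$, $\overline{a}$ denotes the underlying set $\{a_1,\ldots,a_k\}$. Given $\mathcal{Q}=(q_1,\ldots,q_p)\colon I\to\operatorname{Conf}(\mathbb{R}^m,p)$ (the trajectories of $p$ moving obstacles that do not collide with each other), define $$E_n(\mathcal{Q})=\left\{\gamma\colon I\to\operatorname{Conf}(\mathbb{R}^m,n)\text{ continuous}\;\middle|\;\overline{\gamma(t)}\cap\overline{\mathcal{Q}(t)}=\emptyset\text{ for all }t\in I\right\},$$ topologised as a subset of the path space $\operatorname{Conf}(\mathbb{R}^m,n)^I$ (compact-open topology), and $$B_{n,s}(\mathcal{Q})=\left\{(A_1,\ldots,A_s)\in\operatorname{Conf}(\mathbb{R}^m,n)^{s}\;\middle|\;\overline{A_i}\cap\overline{\mathcal{Q}\left(\tfrac{i-1}{s-1}\right)}=\emptyset\text{ for }i=1,\ldots,s\right\},$$ topologised as a subset of the $s$-fold cartesian product. The (reduced) sectional category $\operatorname{secat}(p)$ of a fibration $p\colon E\to B$ is the least integer $\ell\ge0$ such that $B$ can be covered by $\ell+1$ open sets on each of which $p$ admits a continuous section ($\infty$ if there is no such $\ell$). Rudyak's $s$-th (higher) topological complexity $\operatorname{TC}_s(X)$ of a space $X$ is the sectional category of the evaluation fibration $$\pi_s^X\colon X^{[0,1]}\to X^s,\qquad \gamma\mapsto\left(\gamma(0),\gamma\left(\tfrac1{s-1}\right),\ldots,\gamma\left(\tfrac{s-2}{s-1}\right),\gamma(1)\right).$$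 Equivalently, it is the sectional category of the fibration $X^{J_s}\to X^s$, $\gamma\mapsto(\gamma(1_1),\ldots,\gamma(1_s))$, where $J_s$ is the wedge of $s$ copies of $[0,1]$ with base point $0$, and $1_i$ is the endpoint $1$ of the $i$-th copy. *)

theory Defs
  imports "HOL-Analysis.Analysis" "HOL-Library.Extended_Nat"
begin

abbreviation unit_interval :: "real topology" where
  "unit_interval \<equiv> top_of_set {0..1}"

text \<open>A \<open>k\<close>-tuple is a function on \<open>{1..k}\<close>, extended by \<^const>\<open>undefined\<close>; it is a
  configuration if it is injective there. For \<open>k = 0\<close> this gives a one-point space.\<close>

definition Conf :: "'a topology \<Rightarrow> nat \<Rightarrow> (nat \<Rightarrow> 'a) topology" where
  "Conf X k = subtopology (product_topology (\<lambda>_. X) {1..k}) {a. inj_on a {1..k}}"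

definition underlying_set :: "nat \<Rightarrow> (nat \<Rightarrow> 'a) \<Rightarrow> 'a set" where
  "underlying_set k a = a ` {1..k}"

text \<open>The members of \<open>mapping_space X Y\<close> are made extensional, so that each continuous map
  \<open>X \<rightarrow> Y\<close> is represented by exactly one HOL function. Taking \<open>K = {}\<close> in the subbase of the
  compact-open topology shows that its underlying set is all of \<open>mapping_space X Y\<close>.\<close>

definition mapping_space :: "'a topology \<Rightarrow> 'b topology \<Rightarrow> ('a \<Rightarrow> 'b) set" where
  "mapping_space X Y = {f. continuous_map X Y f \<and> f \<in> extensional (topspace X)}"

definition compact_open_topology :: "'a topology \<Rightarrow> 'b topology \<Rightarrow> ('a \<Rightarrow> 'b) topology" where
  "compact_open_topology X Y =
     topology_generated_by
       {{f \<in> mapping_space X Y. f ` K \<subseteq> U} | K U. compactin X K \<and> openin Y U}"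

lemma topspace_compact_open_topology [simp]:
  "topspace (compact_open_topology X Y) = mapping_space X Y"
proof -
  have "mapping_space X Y
        \<in> {{f \<in> mapping_space X Y. f ` K \<subseteq> U} | K U. compactin X K \<and> openin Y U}"
    by (rule CollectI, rule exI[of _ "{}"], rule exI[of _ "{}"]) auto
  then show ?thesis
    unfolding compact_open_topology_def topology_generated_by_topspace by blast
qed

definition path_space :: "'a topology \<Rightarrow> (real \<Rightarrow> 'a) topology" where
  "path_space X = compact_open_topology unit_interval X"

definition eval_map :: "nat \<Rightarrow> (real \<Rightarrow> 'a) \<Rightarrow> (nat \<Rightarrow> 'a)" where
  "eval_map s \<gamma> = (\<lambda>i\<in>{1..s}. \<gamma> ((real i - 1) / (real s - 1)))"

text \<open>Hurewicz fibrations: the homotopy lifting property with respect to all topological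
  spaces. HOL cannot quantify over types inside a formula, so the type \<open>'z\<close> of points of the
  test spaces is a parameter; a theorem that is polymorphic in \<open>'z\<close> covers all test spaces.
  Surjectivity is not part of the notion.\<close>

definition fibration ::
  "'z itself \<Rightarrow> 'e topology \<Rightarrow> 'b topology \<Rightarrow> ('e \<Rightarrow> 'b) \<Rightarrow> bool" where
  "fibration _ E B \<pi> \<longleftrightarrow>
     continuous_map E B \<pi> \<and>
     (\<forall>(Z :: 'z topology) f H.
        continuous_map Z E f \<and>
        continuous_map (prod_topology Z unit_interval) B H \<and>
        (\<forall>z\<in>topspace Z. H (z, 0) = \<pi> (f z))
        \<longrightarrow> (\<exists>G. continuous_map (prod_topology Z unit_interval) E G \<and>
                 (\<forall>z\<in>topspace Z. G (z, 0) = f z) \<and>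
                 (\<forall>z\<in>topspace Z. \<forall>t\<in>{0..1}. \<pi> (G (z, t)) = H (z, t))))"

definition has_section_on ::
  "'e topology \<Rightarrow> 'b topology \<Rightarrow> ('e \<Rightarrow> 'b) \<Rightarrow> 'b set \<Rightarrow> bool" where
  "has_section_on E B \<pi> U \<longleftrightarrow>
     (\<exists>\<sigma>. continuous_map (subtopology B U) E \<sigma> \<and>
          (\<forall>b \<in> topspace B \<inter> U. \<pi> (\<sigma> b) = b))"

text \<open>Reduced sectional category; the infimum of the empty set in \<^typ>\<open>enat\<close> is \<open>\<infinity>\<close>.\<close>

definition secat :: "'e topology \<Rightarrow> 'b topology \<Rightarrow> ('e \<Rightarrow> 'b) \<Rightarrow> enat" where
  "secat E B \<pi> =
     Inf {enat l | l. \<exists>U :: nat \<Rightarrow> 'b set.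
            (\<forall>j\<le>l. openin B (U j) \<and> has_section_on E B \<pi> (U j)) \<and>
            (\<Union>j\<le>l. U j) = topspace B}"

definition TC :: "nat \<Rightarrow> 'a topology \<Rightarrow> enat" where
  "TC s X = secat (path_space X) (product_topology (\<lambda>_. X) {1..s}) (eval_map s)"

definition E_space ::
  "nat \<Rightarrow> nat \<Rightarrow> (real \<Rightarrow> nat \<Rightarrow> real ^ 'm) \<Rightarrow> (real \<Rightarrow> nat \<Rightarrow> real ^ 'm) topology" where
  "E_space n p Q =
     subtopology (path_space (Conf euclidean n))
       {\<gamma>. \<forall>t\<in>{0..1}. underlying_set n (\<gamma> t) \<inter> underlying_set p (Q t) = {}}"

definition B_space ::
  "nat \<Rightarrow> nat \<Rightarrow> nat \<Rightarrow> (real \<Rightarrow> nat \<Rightarrow> real ^ 'm) \<Rightarrow> (nat \<Rightarrow> nat \<Rightarrow> real ^ 'm) topology" where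
  "B_space n s p Q =
     subtopology (product_topology (\<lambda>_. Conf euclidean n) {1..s})
       {A. \<forall>i\<in>{1..s}. underlying_set n (A i)
             \<inter> underlying_set p (Q ((real i - 1) / (real s - 1))) = {}}"

end

theory Submission
  imports Defs
begin

text \<open>
  Small Lipschitz perturbations of the identity are homeomorphisms, so the motion of the obstacles
  is locally followed by an ambient isotopy of \<open>\<real>\<^sup>m\<close>, and these local isotopies compose to a global
  one. After a homeomorphism matching the starting positions of two obstacle families, this gives a
  continuous family \<open>\<Phi>\<^sub>t\<close> of homeomorphisms that carries the obstacles of the first family at time
  \<open>t\<close> to those of the second. Applying \<open>\<Phi>\<^sub>t\<close> at time \<open>t\<close> is a fibrewise homeomorphism. When the
  second family stands still at \<open>Q 0\<close>, the target is the path fibration of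
  \<open>Conf(\<real>\<^sup>m - Q\<^sub>p, n)\<close>, whose homotopy lifting property and sectional category are transported back.
\<close>

section \<open>The exponential law for path spaces\<close>

text \<open>The obstacles move only continuously, so no vector field can be integrated to follow
  them. A short stretch of the motion is instead realised directly by adding bumps, which gives a
  homeomorphism only while the displacements are small compared with the least distance between
  obstacles; hence the detour through local isotopies. Both \<open>E_space\<close> and
  \<open>B_space\<close> see only the underlying sets of the obstacles. The homeomorphism between
  the starting positions may therefore permute labels, and in dimension one this freedom is
  essential: homeomorphisms of the line preserve or reverse order, so an arbitrary bijection of
  labels cannot be realised. The same homeomorphism, the one at time \<open>t\<close>, acts on a
  path at time \<open>t\<close> and on the configuration sampled at \<open>t\<close>; this is why
  moving commutes with evaluation. Continuity of maps into path spaces is always checked on the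
  adjoint, a function of a point and a time.\<close>

lemma continuous_map_path_space_iff:
  "continuous_map Z (path_space X) f \<longleftrightarrow>
     f ` topspace Z \<subseteq> extensional {0..1} \<and>
     continuous_map (prod_topology Z unit_interval) X (\<lambda>(z, t). f z t)"
    (is "?lhs \<longleftrightarrow> ?ext \<and> ?adj")
proof (intro iffI conjI)
  assume L: ?lhs
  then have mem: "f z \<in> mapping_space unit_interval X" if "z \<in> topspace Z" for z
    using that continuous_map_image_subset_topspace[OF L] by (auto simp: path_space_def)
  then show ?ext
    by (auto simp: mapping_space_def)
  show ?adj
    unfolding continuous_map_def
  proof (intro conjI allI impI)
    show "(\<lambda>(z, t). f z t) \<in> topspace (prod_topology Z unit_interval) \<rightarrow> topspace X"
      using mem by (auto simp: mapping_space_def continuous_map_def Pi_iff)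
  next
    fix U assume U: "openin X U"
    let ?W = "{x \<in> topspace (prod_topology Z unit_interval). (case x of (z, t) \<Rightarrow> f z t) \<in> U}"
    show "openin (prod_topology Z unit_interval) ?W"
      unfolding openin_prod_topology_alt
    proof (intro allI impI)
      fix z t assume zt: "(z, t) \<in> ?W"
      then have z: "z \<in> topspace Z" and t: "t \<in> {0..1}" and fU: "f z t \<in> U" by auto
      have cz: "continuous_map unit_interval X (f z)"
        using mem[OF z] by (simp add: mapping_space_def)
      define V where "V = {t \<in> {0..1}. f z t \<in> U}"
      have "openin unit_interval V"
        using openin_continuous_map_preimage[OF cz U] by (simp add: V_def)
      then obtain d where d: "d > 0" "\<And>u. u \<in> {0..1} \<Longrightarrow> dist u t < d \<Longrightarrow> u \<in> V"
        using t fU unfolding openin_euclidean_subtopology_iff V_def by blast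
      \<comment> \<open>Local compactness of the interval enters here: a compact neighbourhood of
        \<open>t\<close> turns the condition on one value into a subbasic open condition on the
        whole path.\<close>
      define K where "K = {0..1} \<inter> cball t (d/2)"
      have K: "compactin unit_interval K"
        by (auto simp: compactin_subtopology K_def intro: compact_Int_closed)
      have KU: "f z ` K \<subseteq> U"
        using d by (fastforce simp: K_def V_def dist_commute)
      define N where "N = {z \<in> topspace Z. f z \<in> {f \<in> mapping_space unit_interval X. f ` K \<subseteq> U}}"
      have "openin Z N"
        unfolding N_def using L K U
        by (intro openin_continuous_map_preimage[where Y = "path_space X"])
          (auto simp: path_space_def compact_open_topology_def intro!: topology_generated_by_Basis)
      moreover have "openin unit_interval ({0..1} \<inter> ball t (d/2))"
        by blast
      moreover have "z \<in> N" using z mem KU by (auto simp: N_def)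
      moreover have "N \<times> ({0..1} \<inter> ball t (d/2)) \<subseteq> ?W"
        by (auto simp: N_def K_def)
      ultimately show "\<exists>U V. openin Z U \<and> openin unit_interval V \<and> z \<in> U \<and> t \<in> V \<and> U \<times> V \<subseteq> ?W"
        using t d(1) by (intro exI[of _ N] exI[of _ "{0..1} \<inter> ball t (d/2)"]) auto
    qed
  qed
next
  assume R: "?ext \<and> ?adj"
  then have adj: ?adj by simp
  have mem: "f z \<in> mapping_space unit_interval X" if "z \<in> topspace Z" for z
  proof -
    have "continuous_map unit_interval (prod_topology Z unit_interval) (\<lambda>t. (z, t))"
      using that by (auto simp: continuous_map_pairwise o_def)
    from continuous_map_compose[OF this adj] R that show ?thesis
      by (auto simp: mapping_space_def o_def)
  qed
  show ?lhs
    unfolding path_space_def compact_open_topology_def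
  proof (rule continuous_on_generated_topo)
    fix G assume "G \<in> {{f \<in> mapping_space unit_interval X. f ` K \<subseteq> U} |K U. compactin unit_interval K \<and> openin X U}"
    then obtain K U where G: "G = {f \<in> mapping_space unit_interval X. f ` K \<subseteq> U}"
      and K: "compactin unit_interval K" and U: "openin X U" by auto
    define W where "W = {x \<in> topspace (prod_topology Z unit_interval). (case x of (z, t) \<Rightarrow> f z t) \<in> U}"
    have W: "openin (prod_topology Z unit_interval) W"
      unfolding W_def using adj U by (rule openin_continuous_map_preimage)
    show "openin Z (f -` G \<inter> topspace Z)"
    proof (subst openin_subopen, intro ballI)
      fix z assume z: "z \<in> f -` G \<inter> topspace Z"
      then have "{z} \<times> K \<subseteq> W"
        using compactin_subset_topspace[OF K] by (auto simp: G W_def)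
      moreover have "compactin Z {z}" using z by auto
      \<comment> \<open>Tube lemma: the slice over \<open>z\<close> is compact, so a product
        neighbourhood of it fits into \<open>W\<close>, and all of \<open>N\<close> satisfies the
        subbasic condition.\<close>
      ultimately obtain N V where N: "openin Z N" "z \<in> N" "K \<subseteq> V" "N \<times> V \<subseteq> W"
        using Wallace_theorem_prod_topology[OF _ K W] by (metis insert_subset)
      have "N \<subseteq> f -` G \<inter> topspace Z"
      proof
        fix y assume y: "y \<in> N"
        then have yZ: "y \<in> topspace Z" using N(1) openin_subset by blast
        have "(y, u) \<in> W" if "u \<in> K" for u using y N(3,4) that by blast
        then have "f y ` K \<subseteq> U" by (auto simp: W_def)
        with mem[OF yZ] yZ show "y \<in> f -` G \<inter> topspace Z" by (simp add: G)
      qed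
      with N show "\<exists>T. openin Z T \<and> z \<in> T \<and> T \<subseteq> f -` G \<inter> topspace Z" by blast
    qed
  next
    show "f ` topspace Z \<subseteq> \<Union> {{f \<in> mapping_space unit_interval X. f ` K \<subseteq> U} |K U. compactin unit_interval K \<and> openin X U}"
    proof (rule image_subsetI)
      fix z assume "z \<in> topspace Z"
      from mem[OF this] show "f z \<in> \<Union> {{f \<in> mapping_space unit_interval X. f ` K \<subseteq> U} |K U. compactin unit_interval K \<and> openin X U}"
        by (intro UnionI[of "{f \<in> mapping_space unit_interval X. f ` {} \<subseteq> {}}"] CollectI exI[of _ "{}"]) auto
    qed
  qed
qed

lemma continuous_map_path_space_eval:
  "continuous_map (prod_topology (path_space X) unit_interval) X (\<lambda>(\<gamma>, t). \<gamma> t)"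
proof -
  have "continuous_map (path_space X) (path_space X) (\<lambda>\<gamma>. \<gamma>)" by simp
  then show ?thesis unfolding continuous_map_path_space_iff by simp
qed

lemma topspace_path_space: "topspace (path_space X) = mapping_space unit_interval X"
  by (simp add: path_space_def)

text \<open>Testing with the two identity maps shows that each topology is finer than the other.
  Equalities between path spaces, products and subspaces thereby reduce to comparing criteria for
  continuity, with no manipulation of subbases.\<close>

lemma topology_eqI_continuous_map:
  fixes X Y :: "'a topology"
  assumes "\<And>(Z :: 'a topology) f. continuous_map Z X f \<longleftrightarrow> continuous_map Z Y f"
  shows "X = Y"
proof -
  have XY: "continuous_map X Y id" "continuous_map Y X id"
    using assms[of X id] assms[of Y id] by auto
  then have top: "topspace X = topspace Y"
    by (auto simp: continuous_map_def)
  have "openin X U \<longleftrightarrow> openin Y U" for U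
    using XY topology_finer_continuous_id[OF top] topology_finer_continuous_id[OF top[symmetric]] by blast
  then show ?thesis by (simp add: topology_eq)
qed

lemma path_space_subtopology:
  "path_space (subtopology X S) = subtopology (path_space X) {\<gamma>. \<forall>t\<in>{0..1}. \<gamma> t \<in> S}"
proof (rule topology_eqI_continuous_map)
  show "continuous_map Z (path_space (subtopology X S)) f \<longleftrightarrow>
      continuous_map Z (subtopology (path_space X) {\<gamma>. \<forall>t\<in>{0..1}. \<gamma> t \<in> S}) f"
    for Z :: "(real \<Rightarrow> 'a) topology" and f
    by (simp add: continuous_map_in_subtopology continuous_map_path_space_iff Pi_iff)
qed

section \<open>Evaluation at finitely many times\<close>

definition sample_time :: "nat \<Rightarrow> nat \<Rightarrow> real" where
  "sample_time s i = (real i - 1) / (real s - 1)"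

lemma sample_time_in_unit: "s \<ge> 2 \<Longrightarrow> i \<in> {1..s} \<Longrightarrow> sample_time s i \<in> {0..1}"
  by (auto simp: sample_time_def divide_simps)

lemma eval_map_alt: "eval_map s \<gamma> = (\<lambda>i\<in>{1..s}. \<gamma> (sample_time s i))"
  by (simp add: eval_map_def sample_time_def)

lemma sample_time_separated:
  assumes "s \<ge> 2" "i \<noteq> j"
  shows "1 / (real s - 1) \<le> \<bar>sample_time s i - sample_time s j\<bar>"
proof -
  have "1 \<le> \<bar>real i - real j\<bar>" using assms(2) by linarith
  moreover have "sample_time s i - sample_time s j = (real i - real j) / (real s - 1)"
    by (simp add: sample_time_def diff_divide_distrib [symmetric])
  ultimately show ?thesis
    using assms(1) by (simp add: abs_divide divide_right_mono)
qed

text \<open>For \<open>w \<ge> 0\<close> this odd function is the identity on [-w, w], returns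
  linearly to 0 at distance 2w and stays 0 beyond. Hence t - \<open>tent w (t - a)\<close> collapses
  [a - w, a + w] to \<open>a\<close> and fixes every \<open>t\<close> at distance at least 2w from
  \<open>a\<close>.\<close>

definition tent :: "real \<Rightarrow> real \<Rightarrow> real" where
  "tent w x = max 0 (min x (2 * w - x)) - max 0 (min (- x) (2 * w + x))"

lemma tent_near: "\<bar>x\<bar> \<le> w \<Longrightarrow> tent w x = x"
  by (auto simp: tent_def max_def min_def abs_if split: if_splits)

lemma tent_far: "0 \<le> w \<Longrightarrow> 2 * w \<le> \<bar>x\<bar> \<Longrightarrow> tent w x = 0"
  by (auto simp: tent_def max_def min_def abs_if split: if_splits)

text \<open>The lift at stage \<open>u\<close> runs through \<open>H\<close> within distance \<open>c u\<close> of each sample time, and elsewhere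
  through \<open>f z\<close> reparametrised by \<open>\<phi> u\<close>, which collapses these neighbourhoods to the sample times.\<close>

lemma fibration_eval_map:
  assumes s: "s \<ge> 2"
  shows "fibration TYPE('z) (path_space X) (product_topology (\<lambda>_. X) {1..s}) (eval_map s)"
  unfolding fibration_def
proof (intro conjI allI impI)
  show "continuous_map (path_space X) (product_topology (\<lambda>_. X) {1..s}) (eval_map s)"
    unfolding continuous_map_componentwise
  proof (intro conjI ballI)
    fix i assume i: "i \<in> {1..s}"
    have "continuous_map (path_space X) (prod_topology (path_space X) unit_interval)
            (\<lambda>\<gamma>. (\<gamma>, sample_time s i))"
      using sample_time_in_unit[OF s i] by (auto simp: continuous_map_pairwise o_def)
    from continuous_map_compose[OF this continuous_map_path_space_eval]
    show "continuous_map (path_space X) X (\<lambda>\<gamma>. eval_map s \<gamma> i)"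
      using i by (simp add: eval_map_alt o_def)
  qed (auto simp: eval_map_alt)
next
  fix Z :: "'z topology" and f H
  assume asm: "continuous_map Z (path_space X) f \<and>
       continuous_map (prod_topology Z unit_interval) (product_topology (\<lambda>_. X) {1..s}) H \<and>
       (\<forall>z\<in>topspace Z. H (z, 0) = eval_map s (f z))"
  define P where "P = prod_topology (prod_topology Z unit_interval) unit_interval"
  \<comment> \<open>A quarter of the spacing of the sample times. A point within
    \<open>c * u\<close> of one sample time is at least 3c from all others, beyond the support
    radius 2cu of their tents, since \<open>u \<le> 1\<close>.\<close>
  define c where "c = 1 / (4 * (real s - 1))"
  \<comment> \<open>Closed pieces for the pasting lemma: index 0, free because sample times are
    numbered from 1, is the region outside all windows; index \<open>j\<close> is the window around
    the \<open>j\<close>-th sample time.\<close>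
  define T where "T j = {x \<in> topspace P. case x of ((z, u), t) \<Rightarrow>
      if j = 0 then \<forall>i\<in>{1..s}. c * u \<le> \<bar>t - sample_time s i\<bar> else \<bar>t - sample_time s j\<bar> \<le> c * u}" for j
  define \<phi> where "\<phi> u t = max 0 (min 1 (t - (\<Sum>i\<in>{1..s}. tent (c * u) (t - sample_time s i))))" for u t
  \<comment> \<open>Inside a window the homotopy parameter falls from \<open>u\<close> at the sample
    time to 0 at the edge, where the distance is \<open>c * u\<close>. At the edge the
    \<open>H\<close> branch thus starts from \<open>f z\<close> at the sample time, which is also
    where \<phi> has arrived.\<close>
  define \<psi> where "\<psi> j u t = max 0 (min 1 (u - \<bar>t - sample_time s j\<bar> / c))" for j u t
  define g where "g j = (\<lambda>((z, u), t). if j = 0 then f z (\<phi> u t) else H (z, \<psi> j u t) j)" for j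
  have c: "c > 0" using s by (simp add: c_def)
  have sep: "4 * c \<le> \<bar>sample_time s i - sample_time s j\<bar>" if "i \<noteq> j" for i j
  proof -
    have "4 * c = 1 / (real s - 1)" using s by (simp add: c_def field_simps)
    then show ?thesis using sample_time_separated[OF s that] by simp
  qed
  have cu: "c * u \<le> c" if "u \<le> 1" for u
    using c that by (simp add: mult_le_cancel_left1)
  have H0: "H (z, 0) i = f z (sample_time s i)" if "z \<in> topspace Z" "i \<in> {1..s}" for z i
    using asm that by (simp add: eval_map_alt)
  have \<phi>_near: "\<phi> u t = sample_time s i"
    if "u \<in> {0..1}" "i \<in> {1..s}" "\<bar>t - sample_time s i\<bar> \<le> c * u" for u t i
  proof -
    have "tent (c * u) (t - sample_time s j) = 0" if "j \<noteq> i" for j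
    proof (rule tent_far)
      show "0 \<le> c * u" using c \<open>u \<in> {0..1}\<close> by simp
      show "2 * (c * u) \<le> \<bar>t - sample_time s j\<bar>"
        using sep[OF that] cu \<open>u \<in> {0..1}\<close> \<open>\<bar>t - sample_time s i\<bar> \<le> c * u\<close>
        unfolding atLeastAtMost_iff by (smt (verit))
    qed
    then have "(\<Sum>j\<in>{1..s}. tent (c * u) (t - sample_time s j)) = tent (c * u) (t - sample_time s i)"
      using \<open>i \<in> {1..s}\<close> by (subst sum.remove[of _ i]) auto
    with that tent_near[of "t - sample_time s i" "c * u"] sample_time_in_unit[OF s, of i]
    show ?thesis by (simp add: \<phi>_def)
  qed
  have \<phi>_0: "\<phi> 0 t = t" if "t \<in> {0..1}" for t
    using that by (simp add: \<phi>_def tent_far)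
  \<comment> \<open>The factor \<open>Z\<close> is an abstract topology, so continuity on
    \<open>P\<close> is reduced once and for all to ordinary continuity in the two real
    parameters.\<close>
  have uv: "continuous_map P euclideanreal (\<lambda>((z, u), t). h (u, t))"
    if "continuous_on UNIV h" for h :: "real \<times> real \<Rightarrow> real"
  proof -
    have "continuous_map P unit_interval (snd \<circ> fst)" "continuous_map P unit_interval snd"
      unfolding P_def
      by (rule continuous_map_compose[OF continuous_map_fst continuous_map_snd], rule continuous_map_snd)
    then have "continuous_map P (prod_topology euclideanreal euclideanreal) (\<lambda>((z, u), t). (u, t))"
      unfolding continuous_map_pairwise
      by (simp add: o_def case_prod_unfold continuous_map_in_subtopology)
    moreover have "continuous_map (prod_topology euclideanreal euclideanreal) euclideanreal h"
      using that by simp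
    ultimately have "continuous_map P euclideanreal (h \<circ> (\<lambda>((z, u), t). (u, t)))"
      by (rule continuous_map_compose)
    then show ?thesis by (simp add: o_def case_prod_unfold)
  qed
  have zuv: "continuous_map P (prod_topology Z unit_interval) (\<lambda>((z, u), t). (z, h (u, t)))"
    if "continuous_on UNIV h" "range h \<subseteq> {0..1}" for h :: "real \<times> real \<Rightarrow> real"
  proof -
    have "continuous_map P Z (\<lambda>x. fst (fst x))"
      unfolding P_def by (intro continuous_map_compose[OF continuous_map_fst, unfolded o_def] continuous_map_fst)
    then show ?thesis
      using uv[OF that(1)] that(2)
      by (auto simp: continuous_map_pairwise o_def case_prod_unfold continuous_map_in_subtopology)
  qed
  have contg: "continuous_map P X (g j)" if "j \<in> {0..s}" for j
  proof (cases "j = 0")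
    case True
    have "continuous_on UNIV (\<lambda>x. \<phi> (fst x) (snd x))"
      unfolding \<phi>_def tent_def by (intro continuous_intros)
    moreover have "range (\<lambda>x. \<phi> (fst x) (snd x)) \<subseteq> {0..1}"
      by (auto simp: \<phi>_def)
    ultimately have 1: "continuous_map P (prod_topology Z unit_interval) (\<lambda>((z, u), t). (z, \<phi> u t))"
      by (drule_tac zuv) (simp_all only: fst_conv snd_conv)
    have 2: "continuous_map (prod_topology Z unit_interval) X (\<lambda>(z, t). f z t)"
      using asm by (simp add: continuous_map_path_space_iff)
    show ?thesis using continuous_map_compose[OF 1 2] True
      by (simp add: g_def o_def case_prod_unfold)
  next
    case False
    have "continuous_on UNIV (\<lambda>x. \<psi> j (fst x) (snd x))"
      unfolding \<psi>_def using c by (intro continuous_intros) auto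
    moreover have "range (\<lambda>x. \<psi> j (fst x) (snd x)) \<subseteq> {0..1}"
      by (auto simp: \<psi>_def)
    ultimately have 1: "continuous_map P (prod_topology Z unit_interval) (\<lambda>((z, u), t). (z, \<psi> j u t))"
      by (drule_tac zuv) (simp_all only: fst_conv snd_conv)
    have 2: "continuous_map (prod_topology Z unit_interval) X (\<lambda>x. H x j)"
      using asm that False by (auto simp: continuous_map_componentwise)
    show ?thesis using continuous_map_compose[OF 1 2] False
      by (simp add: g_def o_def case_prod_unfold)
  qed
  have closed_le: "closedin P {x \<in> topspace P. case x of ((z, u), t) \<Rightarrow> h (u, t) \<le> 0}"
    if "continuous_on UNIV h" for h :: "real \<times> real \<Rightarrow> real"
    using closedin_continuous_map_preimage[OF uv[OF that], of "{..0}"]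
    by (simp add: case_prod_unfold)
  have "closedin P (T j)" if "j \<in> {0..s}" for j
  proof (cases "j = 0")
    case True
    have "T j = topspace P \<inter> (\<Inter>i\<in>{1..s}. {x \<in> topspace P. case x of ((z, u), t) \<Rightarrow>
                  c * fst (u, t) - \<bar>snd (u, t) - sample_time s i\<bar> \<le> 0})"
      using s by (auto simp: T_def True)
    also have "closedin P \<dots>"
      using s by (intro closedin_Int closedin_topspace closedin_INT closed_le continuous_intros) auto
    finally show ?thesis .
  next
    case False
    have "T j = {x \<in> topspace P. case x of ((z, u), t) \<Rightarrow>
                  \<bar>snd (u, t) - sample_time s j\<bar> - c * fst (u, t) \<le> 0}"
      using False by (auto simp: T_def)
    also have "closedin P \<dots>"
      by (intro closed_le continuous_intros)
    finally show ?thesis .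
  qed
  moreover have "topspace P \<subseteq> \<Union> (T ` {0..s})"
  proof
    fix x assume x: "x \<in> topspace P"
    obtain z u t where [simp]: "x = ((z, u), t)" by (metis prod.collapse)
    show "x \<in> \<Union> (T ` {0..s})"
    proof (cases "\<forall>i\<in>{1..s}. c * u \<le> \<bar>t - sample_time s i\<bar>")
      case True
      then have "x \<in> T 0" using x by (simp add: T_def)
      then show ?thesis by force
    next
      case False
      then obtain i where i: "i \<in> {1..s}" "\<bar>t - sample_time s i\<bar> \<le> c * u" by force
      then have "x \<in> T i" using x by (simp add: T_def)
      then show ?thesis using i by force
    qed
  qed
  moreover have "g i x = g j x"
    if "i \<in> {0..s}" "j \<in> {0..s}" "x \<in> topspace P \<inter> T i \<inter> T j" for i j x
  proof -
    obtain z u t where x: "x = ((z, u), t)" by (metis prod.collapse)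
    have z: "z \<in> topspace Z" and u: "u \<in> {0..1}" and t: "t \<in> {0..1}"
      using that by (auto simp: x P_def)
    have *: "g 0 x = g j x" if "x \<in> T 0" "x \<in> T j" "j \<in> {1..s}" for j
    proof -
      have eq: "\<bar>t - sample_time s j\<bar> = c * u"
        using that by (force simp: T_def x)
      then have "\<psi> j u t = 0" using c by (simp add: \<psi>_def)
      moreover have "\<phi> u t = sample_time s j" using \<phi>_near[OF u that(3)] eq by simp
      ultimately show ?thesis using that z by (simp add: g_def x H0)
    qed
    show ?thesis
    proof (cases "i = 0 \<or> j = 0")
      case True
      then show ?thesis using * that
        by (metis Int_iff One_nat_def Suc_leI atLeastAtMost_iff gr0I)
    next
      case False
      then have "\<bar>t - sample_time s i\<bar> \<le> c * u" "\<bar>t - sample_time s j\<bar> \<le> c * u"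
        using that by (auto simp: T_def x)
      then have "i = j" using sep[of i j] cu[of u] u c by fastforce
      then show ?thesis by simp
    qed
  qed
  ultimately obtain k where k: "continuous_map P X k"
    "\<And>x i. i \<in> {0..s} \<Longrightarrow> x \<in> topspace P \<inter> T i \<Longrightarrow> k x = g i x"
    using pasting_lemma_exists_closed[of "{0..s}" P T X g] contg
    by (metis continuous_map_from_subtopology finite_atLeastAtMost)
  define G where "G x = (\<lambda>t\<in>{0..1}. k (x, t))" for x
  have "continuous_map (prod_topology Z unit_interval) (path_space X) G"
    unfolding continuous_map_path_space_iff
  proof
    show "continuous_map (prod_topology (prod_topology Z unit_interval) unit_interval) X (\<lambda>(z, t). G z t)"
      by (rule continuous_map_eq[OF k(1)[unfolded P_def]]) (auto simp: G_def)
  qed (auto simp: G_def)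
  moreover have "G (z, 0) = f z" if z: "z \<in> topspace Z" for z
  proof -
    have "f z \<in> extensional {0..1}"
      using asm z by (auto simp: continuous_map_path_space_iff)
    moreover have "G (z, 0) t = f z t" if t: "t \<in> {0..1}" for t
    proof -
      \<comment> \<open>At \<open>u = 0\<close> the windows have radius 0, so every time lies in
        piece 0, where \<phi> is the identity.\<close>
      have "((z, 0), t) \<in> topspace P \<inter> T 0"
        using z t by (auto simp: P_def T_def)
      from k(2)[OF _ this] have "k ((z, 0), t) = f z t"
        using t by (simp add: g_def \<phi>_0)
      then show ?thesis using t by (simp add: G_def)
    qed
    ultimately show ?thesis
      by (intro extensionalityI[of _ "{0..1}"]) (auto simp: G_def)
  qed
  moreover have "eval_map s (G (z, u)) = H (z, u)" if z: "z \<in> topspace Z" and u: "u \<in> {0..1}" for z u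
  proof -
    have "H (z, u) \<in> extensional {1..s}"
      using asm z u by (auto simp: continuous_map_componentwise)
    moreover have "G (z, u) (sample_time s i) = H (z, u) i" if i: "i \<in> {1..s}" for i
    proof -
      have "((z, u), sample_time s i) \<in> topspace P \<inter> T i"
        using z u i sample_time_in_unit[OF s i] c by (auto simp: P_def T_def)
      from k(2)[OF _ this] have "k ((z, u), sample_time s i) = H (z, u) i"
        using i u by (simp add: g_def \<psi>_def)
      then show ?thesis using sample_time_in_unit[OF s i] by (simp add: G_def)
    qed
    ultimately show ?thesis
      by (intro extensionalityI[of _ "{1..s}"]) (auto simp: eval_map_alt)
  qed
  ultimately show "\<exists>G. continuous_map (prod_topology Z unit_interval) (path_space X) G \<and>
             (\<forall>z\<in>topspace Z. G (z, 0) = f z) \<and>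
             (\<forall>z\<in>topspace Z. \<forall>t\<in>{0..1}. eval_map s (G (z, t)) = H (z, t))"
    by blast
qed

section \<open>Ambient isotopies\<close>

text \<open>The inverses are carried as data with their own joint continuity, so that moving paths
  is again continuous backwards. The parameter set is arbitrary, so that short time intervals can be
  treated before they are glued.\<close>

definition homeo_family :: "'t::topological_space set \<Rightarrow> ('t \<Rightarrow> 'a \<Rightarrow> 'a) \<Rightarrow> ('t \<Rightarrow> 'a \<Rightarrow> 'a::topological_space) \<Rightarrow> bool" where
  "homeo_family S \<Phi> \<Psi> \<longleftrightarrow>
     continuous_on (S \<times> UNIV) (\<lambda>(t, x). \<Phi> t x) \<and>
     continuous_on (S \<times> UNIV) (\<lambda>(t, x). \<Psi> t x) \<and>
     (\<forall>t\<in>S. \<forall>x. \<Phi> t (\<Psi> t x) = x \<and> \<Psi> t (\<Phi> t x) = x)"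

lemma homeo_family_inverse: "homeo_family S \<Phi> \<Psi> \<Longrightarrow> homeo_family S \<Psi> \<Phi>"
  by (simp add: homeo_family_def)

lemma continuous_on_family_comp:
  assumes "continuous_on (S \<times> UNIV) (\<lambda>(t, x). F t x)" "continuous_on (S \<times> UNIV) (\<lambda>(t, x). G t x)"
  shows "continuous_on (S \<times> UNIV) (\<lambda>(t, x). F t (G t x))"
proof -
  have "continuous_on (S \<times> UNIV) (\<lambda>y. (fst y, G (fst y) (snd y)))"
    using assms(2) by (intro continuous_intros) (simp add: case_prod_unfold)
  from continuous_on_compose2[OF assms(1) this] show ?thesis
    by (simp add: case_prod_unfold image_subset_iff mem_Times_iff)
qed

lemma homeo_family_comp:
  assumes "homeo_family S \<Phi> \<Psi>" "homeo_family S \<Phi>' \<Psi>'"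
  shows "homeo_family S (\<lambda>t x. \<Phi> t (\<Phi>' t x)) (\<lambda>t x. \<Psi>' t (\<Psi> t x))"
  using assms unfolding homeo_family_def by (simp add: continuous_on_family_comp)

lemma homeo_family_const:
  assumes "homeo_family S \<Phi> \<Psi>" "a \<in> S"
  shows "homeo_family T (\<lambda>t. \<Phi> a) (\<lambda>t. \<Psi> a)"
proof -
  have "continuous_on UNIV (\<lambda>x. F a x)" if "continuous_on (S \<times> UNIV) (\<lambda>(t, x). F t x)" for F
  proof -
    have "continuous_on UNIV (\<lambda>x. (a, x))" by (intro continuous_intros)
    from continuous_on_compose2[OF that this] assms(2) show ?thesis by auto
  qed
  then have "continuous_on UNIV (\<Phi> a)" "continuous_on UNIV (\<Psi> a)"
    using assms unfolding homeo_family_def by auto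
  then have "continuous_on (T \<times> UNIV) (\<lambda>y. \<Phi> a (snd y))" "continuous_on (T \<times> UNIV) (\<lambda>y. \<Psi> a (snd y))"
    by (auto intro: continuous_on_compose2[OF _ continuous_on_snd[OF continuous_on_id]])
  then show ?thesis
    using assms by (simp add: homeo_family_def case_prod_unfold)
qed

lemma homeo_family_glue:
  fixes a b c :: real
  assumes "a \<le> b" "b \<le> c" and 1: "homeo_family {a..b} \<Phi> \<Psi>" and 2: "homeo_family {b..c} \<Phi>' \<Psi>'"
    and eq: "\<And>x. \<Phi> b x = \<Phi>' b x"
  shows "homeo_family {a..c} (\<lambda>t. if t \<le> b then \<Phi> t else \<Phi>' t) (\<lambda>t. if t \<le> b then \<Psi> t else \<Psi>' t)"
proof -
  \<comment> \<open>At time \<open>b\<close> both are two-sided inverses of the same map; therefore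
    the inverse families can be pasted as well.\<close>
  have eq': "\<Psi> b x = \<Psi>' b x" for x
    using 1 2 eq assms(1,2) unfolding homeo_family_def by (metis atLeastAtMost_iff order_refl)
  have U: "{a..c} \<times> UNIV = {a..b} \<times> UNIV \<union> {b..c} \<times> (UNIV :: 'a set)"
    using assms(1,2) by auto
  have glue: "continuous_on ({a..c} \<times> UNIV) (\<lambda>(t, x). (if t \<le> b then F t else G t) x)"
    if "continuous_on ({a..b} \<times> UNIV) (\<lambda>(t, x). F t x)" "continuous_on ({b..c} \<times> UNIV) (\<lambda>(t, x). G t x)"
      "\<And>x. F b x = G b x" for F G :: "real \<Rightarrow> 'a \<Rightarrow> 'a"
  proof -
    have "continuous_on ({a..b} \<times> UNIV \<union> {b..c} \<times> UNIV)
            (\<lambda>y. if fst y \<le> b then (\<lambda>(t, x). F t x) y else (\<lambda>(t, x). G t x) y)"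
      by (intro continuous_on_cases that(1,2) closed_Times closed_UNIV closed_atLeastAtMost)
        (use that(3) order_antisym in fastforce)
    moreover have "(\<lambda>y. if fst y \<le> b then (\<lambda>(t, x). F t x) y else (\<lambda>(t, x). G t x) y) =
        (\<lambda>(t, x). (if t \<le> b then F t else G t) x)" by auto
    ultimately show ?thesis unfolding U by (simp only:)
  qed
  show ?thesis
    using 1 2 glue[of \<Phi> \<Phi>'] glue[of \<Psi> \<Psi>'] eq eq' unfolding homeo_family_def by auto
qed

text \<open>Banach's fixed point theorem inverts a Lipschitz perturbation of the identity.\<close>

lemma homeo_family_perturbation:
  fixes g :: "'t::metric_space \<Rightarrow> 'a::banach \<Rightarrow> 'a"
  assumes cont: "continuous_on (S \<times> UNIV) (\<lambda>(t, x). g t x)"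
    and lip: "\<And>t x y. t \<in> S \<Longrightarrow> norm (g t x - g t y) \<le> norm (x - y) / 2"
  obtains \<Psi> where "homeo_family S (\<lambda>t x. x + g t x) \<Psi>"
proof -
  \<comment> \<open>Inverting the perturbation at \<open>z\<close> means finding a fixed point of x
    \<mapsto> z - \<open>g t x\<close>, a contraction with constant 1/2.\<close>
  have "\<exists>!x. z - g t x = x" if "t \<in> S" for t z
  proof (rule banach_fix_type[of "1/2"])
    show "\<forall>x y. dist (z - g t x) (z - g t y) \<le> 1 / 2 * dist x y"
      using lip[OF that] by (simp add: dist_norm norm_minus_commute)
  qed auto
  then have ex1: "\<exists>!x. x + g t x = z" if "t \<in> S" for t z
    using that by (metis add_diff_cancel diff_add_cancel)
  define \<Psi> where "\<Psi> t z = (THE x. x + g t x = z)" for t z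
  have \<Psi>1: "\<Psi> t z + g t (\<Psi> t z) = z" if "t \<in> S" for t z
    unfolding \<Psi>_def using theI'[OF ex1[OF that]] .
  have \<Psi>2: "\<Psi> t (x + g t x) = x" if "t \<in> S" for t x
    unfolding \<Psi>_def using ex1[OF that] by (intro the1_equality) auto
  \<comment> \<open>Half of the distance on the left is absorbed by the Lipschitz term, whence the
    factor 2. On the right \<open>g\<close> is evaluated at one fixed point
    \<open>\<Psi> t' z'\<close>, so its continuity in time there yields joint continuity of the
    inverse.\<close>
  have bound: "norm (\<Psi> t z - \<Psi> t' z') \<le> 2 * (norm (z - z') + norm (g t (\<Psi> t' z') - g t' (\<Psi> t' z')))"
    if "t \<in> S" "t' \<in> S" for t t' z z'
  proof -
    define x x' where "x = \<Psi> t z" and "x' = \<Psi> t' z'"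
    have "x - x' = (z - z') - (g t x - g t x') - (g t x' - g t' x')"
      using \<Psi>1[OF that(1), of z] \<Psi>1[OF that(2), of z'] unfolding x_def x'_def by (simp add: algebra_simps)
    then have "norm (x - x') \<le> norm (z - z') + norm (g t x - g t x') + norm (g t x' - g t' x')"
      by (smt (verit) norm_triangle_ineq4)
    with lip[OF that(1), of x x'] show ?thesis by (simp add: x_def x'_def)
  qed
  have "continuous_on (S \<times> UNIV) (\<lambda>(t, x). \<Psi> t x)"
    unfolding continuous_on_def
  proof
    fix p :: "'t \<times> 'a" assume p: "p \<in> S \<times> UNIV"
    obtain t' z' where [simp]: "p = (t', z')" by fastforce
    define R where "R y = 2 * (norm (snd y - z') + norm (g (fst y) (\<Psi> t' z') - g t' (\<Psi> t' z')))" for y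
    have "continuous_on (S \<times> UNIV) (\<lambda>y::'t \<times> 'a. (fst y, \<Psi> t' z'))"
      by (intro continuous_intros)
    from continuous_on_compose2[OF cont this]
    have "continuous_on (S \<times> UNIV) (\<lambda>y::'t \<times> 'a. g (fst y) (\<Psi> t' z'))"
      by (simp add: image_subset_iff mem_Times_iff)
    then have "continuous_on (S \<times> UNIV) R"
      unfolding R_def by (intro continuous_intros)
    then have "(R \<longlongrightarrow> R p) (at p within S \<times> UNIV)"
      using p unfolding continuous_on_def by (rule bspec)
    then have "(R \<longlongrightarrow> 0) (at p within S \<times> UNIV)"
      by (simp add: R_def)
    moreover have "\<forall>\<^sub>F y in at p within S \<times> UNIV. norm ((\<lambda>(t, x). \<Psi> t x) y - \<Psi> t' z') \<le> R y"
      unfolding eventually_at_filter using bound p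
      by (intro always_eventually) (auto simp: R_def simp del: distrib_left_numeral)
    ultimately have "((\<lambda>y. (\<lambda>(t, x). \<Psi> t x) y - \<Psi> t' z') \<longlongrightarrow> 0) (at p within S \<times> UNIV)"
      by (rule Lim_null_comparison[rotated])
    then show "((\<lambda>(t, x). \<Psi> t x) \<longlongrightarrow> (\<lambda>(t, x). \<Psi> t x) p) (at p within S \<times> UNIV)"
      by (simp add: Lim_null[symmetric])
  qed
  moreover have "continuous_on (S \<times> UNIV) (\<lambda>(t, x). x + g t x)"
    using cont unfolding case_prod_unfold by (intro continuous_intros)
  ultimately have "homeo_family S (\<lambda>t x. x + g t x) \<Psi>"
    by (simp add: homeo_family_def \<Psi>1 \<Psi>2)
  then show ?thesis by (rule that)
qed

text \<open>A cone of height 1 and radius \<delta> around each \<open>q x i\<close> carries the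
  displacement of that point. Each cone vanishes at the other centres, so every obstacle lands
  exactly at its target. Elsewhere cones may overlap, but the sum has Lipschitz constant at most
  \<open>card I\<close> * \<epsilon> / \<delta>.\<close>

lemma local_ambient_isotopy:
  fixes q :: "real \<Rightarrow> 'i \<Rightarrow> 'a::banach"
  assumes fin: "finite I" and cont: "\<And>i. i \<in> I \<Longrightarrow> continuous_on S (\<lambda>t. q t i)"
    and x: "x \<in> S" and inj: "inj_on (q x) I"
  obtains d where "d > 0"
    "\<And>T. T \<subseteq> S \<inter> ball x d \<Longrightarrow>
       \<exists>\<Phi> \<Psi>. homeo_family T \<Phi> \<Psi> \<and> (\<forall>t\<in>T. \<forall>i\<in>I. \<Phi> t (q x i) = q t i)"
proof -
  \<comment> \<open>The inserted 1 gives the minimum a positive value when there are no two distinct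
    indices.\<close>
  define \<delta> where "\<delta> = Min (insert 1 ((\<lambda>(i, j). dist (q x i) (q x j)) ` {(i, j) \<in> I \<times> I. i \<noteq> j}))"
  have fin2: "finite {(i, j) \<in> I \<times> I. i \<noteq> j}"
    by (rule finite_subset[of _ "I \<times> I"]) (auto simp: fin)
  have \<delta>: "\<delta> > 0"
    unfolding \<delta>_def using fin2 inj by (subst Min_gr_iff) (auto simp: inj_on_def)
  have \<delta>_le: "\<delta> \<le> dist (q x i) (q x j)" if "i \<in> I" "j \<in> I" "i \<noteq> j" for i j
    unfolding \<delta>_def using fin2 that by (intro Min_le) auto
  \<comment> \<open>Chosen so that \<open>card I\<close> * \<epsilon> / \<delta> is at most 1/2, as
    the inversion of perturbations requires; the added 1 keeps the denominator positive for empty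
    \<open>I\<close>.\<close>
  define \<epsilon> where "\<epsilon> = \<delta> / (2 * (real (card I) + 1))"
  have \<epsilon>: "\<epsilon> > 0" using \<delta> by (simp add: \<epsilon>_def add_nonneg_pos)
  have "\<forall>\<^sub>F t in at x within S. dist (q t i) (q x i) < \<epsilon>" if "i \<in> I" for i
    using cont[OF that] x \<epsilon> by (auto simp: continuous_on_def tendsto_iff)
  then have "\<forall>\<^sub>F t in at x within S. \<forall>i\<in>I. dist (q t i) (q x i) < \<epsilon>"
    by (intro eventually_ball_finite fin) auto
  then obtain d where d: "d > 0" "\<And>t i. t \<in> S \<Longrightarrow> t \<noteq> x \<Longrightarrow> dist t x < d \<Longrightarrow> i \<in> I \<Longrightarrow> dist (q t i) (q x i) < \<epsilon>"
    unfolding eventually_at by blast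
  have d': "norm (q t i - q x i) \<le> \<epsilon>" if "t \<in> S \<inter> ball x d" "i \<in> I" for t i
    using d(2)[of t i] that \<epsilon> by (cases "t = x") (auto simp: dist_norm norm_minus_commute abs_minus_commute)
  show ?thesis
  proof
    show "d > 0" by (rule d)
    fix T assume T: "T \<subseteq> S \<inter> ball x d"
    define \<mu> where "\<mu> i y = max 0 (1 - dist y (q x i) / \<delta>)" for i y
    define g where "g t y = (\<Sum>i\<in>I. \<mu> i y *\<^sub>R (q t i - q x i))" for t y
    have "continuous_on (T \<times> UNIV) (\<lambda>y::real \<times> 'a. q (fst y) i)" if "i \<in> I" for i
      using T by (intro continuous_on_compose2[OF cont[OF that]]) (auto intro: continuous_intros)
    then have cg: "continuous_on (T \<times> UNIV) (\<lambda>(t, y). g t y)"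
      unfolding g_def \<mu>_def case_prod_unfold using \<delta>
      by (intro continuous_on_sum continuous_intros) auto
    have lam_lip: "\<bar>\<mu> i y - \<mu> i z\<bar> \<le> norm (y - z) / \<delta>" for i y z
    proof -
      have "\<bar>\<mu> i y - \<mu> i z\<bar> \<le> \<bar>dist y (q x i) / \<delta> - dist z (q x i) / \<delta>\<bar>"
        unfolding \<mu>_def by (simp add: max_def abs_if)
      also have "\<dots> = \<bar>dist y (q x i) - dist z (q x i)\<bar> / \<delta>"
        using \<delta> by (simp add: diff_divide_distrib [symmetric])
      also have "\<dots> \<le> norm (y - z) / \<delta>"
        using \<delta> norm_triangle_ineq3[of "y - q x i" "z - q x i"]
        by (intro divide_right_mono) (auto simp: dist_norm)
      finally show ?thesis .
    qed
    have lip: "norm (g t y - g t z) \<le> norm (y - z) / 2" if t: "t \<in> T" for t y z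
    proof -
      have "norm (g t y - g t z) = norm (\<Sum>i\<in>I. (\<mu> i y - \<mu> i z) *\<^sub>R (q t i - q x i))"
        by (simp add: g_def sum_subtractf [symmetric] scaleR_diff_left)
      also have "\<dots> \<le> (\<Sum>i\<in>I. norm (y - z) / \<delta> * \<epsilon>)"
      proof (rule sum_norm_le)
        fix i assume "i \<in> I"
        then show "norm ((\<mu> i y - \<mu> i z) *\<^sub>R (q t i - q x i)) \<le> norm (y - z) / \<delta> * \<epsilon>"
          unfolding norm_scaleR using \<delta> t T by (intro mult_mono lam_lip d') auto
      qed
      also have "\<dots> = norm (y - z) / 2 * (real (card I) / (real (card I) + 1))"
        using \<delta> by (simp add: \<epsilon>_def divide_simps)
      also have "\<dots> \<le> norm (y - z) / 2 * 1"
        by (intro mult_left_mono) (auto simp: divide_simps)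
      finally show ?thesis by simp
    qed
    obtain \<Psi> where \<Psi>: "homeo_family T (\<lambda>t y. y + g t y) \<Psi>"
      using homeo_family_perturbation[OF cg lip] by blast
    have "q x i + g t (q x i) = q t i" if "i \<in> I" for t i
    proof -
      have "g t (q x i) = (\<Sum>j\<in>I. if j = i then q t i - q x i else 0)"
        unfolding g_def using \<delta> \<delta>_le[OF that]
        by (intro sum.cong) (auto simp: \<mu>_def max_def divide_simps intro: order_antisym)
      then show ?thesis using that fin by simp
    qed
    with \<Psi> show "\<exists>\<Phi> \<Psi>. homeo_family T \<Phi> \<Psi> \<and> (\<forall>t\<in>T. \<forall>i\<in>I. \<Phi> t (q x i) = q t i)"
      by blast
  qed
qed

text \<open>Bisection on the time interval: isotopies exist on all sufficiently short intervals
  around each time, and isotopies on adjacent intervals can be concatenated.\<close>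

theorem ambient_isotopy:
  fixes q :: "real \<Rightarrow> 'i \<Rightarrow> 'a::banach"
  assumes fin: "finite I" and cont: "\<And>i. i \<in> I \<Longrightarrow> continuous_on {0..1} (\<lambda>t. q t i)"
    and inj: "\<And>t. t \<in> {0..1} \<Longrightarrow> inj_on (q t) I"
  obtains \<Phi> \<Psi> where "homeo_family {0..1} \<Phi> \<Psi>" "\<And>t i. t \<in> {0..1} \<Longrightarrow> i \<in> I \<Longrightarrow> \<Phi> t (q 0 i) = q t i"
proof -
  \<comment> \<open>The starting points \<open>c\<close> are left open because a local isotopy
    starts from the obstacles at its own centre \<open>x\<close>, not at an endpoint. The guard
    makes \<open>P\<close> trivially true on intervals that leave [0,1], which the local condition
    of \<open>Bolzano\<close> also tests.\<close>
  define P where "P a b \<longleftrightarrow> (0 \<le> a \<and> b \<le> 1 \<longrightarrow>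
    (\<exists>\<Phi> \<Psi> c. homeo_family {a..b} \<Phi> \<Psi> \<and> (\<forall>t\<in>{a..b}. \<forall>i\<in>I. \<Phi> t (c i) = q t i)))" for a b
  have "(0::real) \<le> 1" by simp
  then have "P 0 1"
  proof (induction rule: Bolzano)
    case (trans a b c)
    show ?case unfolding P_def
    proof
      assume bd: "0 \<le> a \<and> c \<le> 1"
      then have "0 \<le> a \<and> b \<le> 1" "0 \<le> b \<and> c \<le> 1" using trans(3,4) by auto
      with trans(1,2) obtain \<Phi> \<Psi> u \<Phi>' \<Psi>' v where
        1: "homeo_family {a..b} \<Phi> \<Psi>" "\<And>t i. t\<in>{a..b} \<Longrightarrow> i\<in>I \<Longrightarrow> \<Phi> t (u i) = q t i" and
        2: "homeo_family {b..c} \<Phi>' \<Psi>'" "\<And>t i. t\<in>{b..c} \<Longrightarrow> i\<in>I \<Longrightarrow> \<Phi>' t (v i) = q t i"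
        unfolding P_def by (elim impE exE conjE) (assumption | blast)+
      have b: "b \<in> {a..b}" "b \<in> {b..c}" using trans by auto
      have inv: "\<Psi>' b (\<Phi>' b x) = x" "\<Phi>' b (\<Psi>' b x) = x" for x
        using 2(1) b by (auto simp: homeo_family_def)
      \<comment> \<open>Precomposition with a fixed homeomorphism makes the second isotopy agree
        with the first at time \<open>b\<close>; it carries the starting points \<open>u i\<close>
        to \<open>v i\<close>.\<close>
      let ?F = "\<lambda>t x. \<Phi>' t (\<Psi>' b (\<Phi> b x))" and ?G = "\<lambda>t x. \<Psi> b (\<Phi>' b (\<Psi>' t x))"
      have "homeo_family {b..c} ?F ?G"
        by (rule homeo_family_comp[OF 2(1) homeo_family_comp
              [OF homeo_family_const[OF homeo_family_inverse[OF 2(1)] b(2)] homeo_family_const[OF 1(1) b(1)]]])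
      then have "homeo_family {a..c} (\<lambda>t. if t \<le> b then \<Phi> t else ?F t) (\<lambda>t. if t \<le> b then \<Psi> t else ?G t)"
        using trans by (intro homeo_family_glue 1(1)) (auto simp: inv)
      moreover have "(if t \<le> b then \<Phi> t else ?F t) (u i) = q t i" if "t \<in> {a..c}" "i \<in> I" for t i
      proof -
        have "\<Psi>' b (\<Phi> b (u i)) = v i"
          using 1(2)[OF b(1)] 2(2)[OF b(2)] that inv by metis
        then show ?thesis using 1(2)[of t i] 2(2)[of t i] that by auto
      qed
      ultimately show "\<exists>\<Phi> \<Psi> u. homeo_family {a..c} \<Phi> \<Psi> \<and> (\<forall>t\<in>{a..c}. \<forall>i\<in>I. \<Phi> t (u i) = q t i)"
        by (intro exI[of _ "\<lambda>t. if t \<le> b then \<Phi> t else ?F t"] exI[of _ "\<lambda>t. if t \<le> b then \<Psi> t else ?G t"]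
              exI[of _ u]) auto
    qed
  next
    case (local x)
    then have x: "x \<in> {0..1}" by simp
    from local_ambient_isotopy[OF fin cont x inj[OF x]] obtain d where d: "d > 0"
      "\<And>T. T \<subseteq> {0..1} \<inter> ball x d \<Longrightarrow>
       \<exists>\<Phi> \<Psi>. homeo_family T \<Phi> \<Psi> \<and> (\<forall>t\<in>T. \<forall>i\<in>I. \<Phi> t (q x i) = q t i)" by metis
    have "P a b" if "a \<le> x" "x \<le> b" "b - a < d" for a b
      unfolding P_def
    proof
      assume "0 \<le> a \<and> b \<le> 1"
      then have "{a..b} \<subseteq> {0..1} \<inter> ball x d" using that by (auto simp: dist_real_def)
      from d(2)[OF this] show "\<exists>\<Phi> \<Psi> c. homeo_family {a..b} \<Phi> \<Psi> \<and> (\<forall>t\<in>{a..b}. \<forall>i\<in>I. \<Phi> t (c i) = q t i)"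
        by blast
    qed
    with d(1) show ?case by blast
  qed
  then have "\<exists>\<Phi> \<Psi> c. homeo_family {0..1} \<Phi> \<Psi> \<and> (\<forall>t\<in>{0..1}. \<forall>i\<in>I. \<Phi> t (c i) = q t i)"
    by (simp add: P_def)
  then obtain \<Phi> \<Psi> c where 1: "homeo_family {0..1} \<Phi> \<Psi>" and 2: "\<And>t i. t\<in>{0..1} \<Longrightarrow> i\<in>I \<Longrightarrow> \<Phi> t (c i) = q t i"
    by blast
  show ?thesis
  proof
    \<comment> \<open>Precomposing with \<open>\<Psi> 0\<close> replaces the unknown starting points
      by the obstacles at time 0.\<close>
    show "homeo_family {0..1} (\<lambda>t x. \<Phi> t (\<Psi> 0 x)) (\<lambda>t x. \<Phi> 0 (\<Psi> t x))"
      by (rule homeo_family_comp[OF 1 homeo_family_const[OF homeo_family_inverse[OF 1]]]) auto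
    have "\<Psi> 0 (q 0 i) = c i" if "i \<in> I" for i
      using 1 2[of 0 i] that by (metis atLeastAtMost_iff homeo_family_def order_refl zero_le_one)
    then show "\<Phi> t (\<Psi> 0 (q 0 i)) = q t i" if "t \<in> {0..1}" "i \<in> I" for t i
      using 2 that by simp
  qed
qed

section \<open>Matching finite sets of equal size by a homeomorphism\<close>

text \<open>The vectors that fail to separate two given distinct points form a hyperplane, and
  finitely many hyperplanes, being null sets, do not cover the space.\<close>

lemma generic_functional:
  fixes S :: "'a::euclidean_space set"
  assumes "finite S"
  obtains v where "inj_on ((\<bullet>) v) S"
proof -
  define D where "D = (\<lambda>(x, y). x - y) ` {(x, y) \<in> S \<times> S. x \<noteq> y}"
  have "finite D"
    unfolding D_def by (rule finite_imageI, rule finite_subset[of _ "S \<times> S"]) (auto simp: assms)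
  then have "negligible (\<Union>d\<in>D. {v. d \<bullet> v = 0})"
    by (intro negligible_Union finite_imageI) (auto simp: D_def intro!: negligible_hyperplane)
  then obtain v where v: "v \<notin> (\<Union>d\<in>D. {v. d \<bullet> v = 0})"
    using non_negligible_UNIV by (metis UNIV_eq_I)
  have "inj_on ((\<bullet>) v) S"
  proof (rule inj_onI, rule ccontr)
    fix x y assume "x \<in> S" "y \<in> S" "v \<bullet> x = v \<bullet> y" "x \<noteq> y"
    then have "x - y \<in> D" "(x - y) \<bullet> v = 0"
      by (force simp: D_def, metis inner_commute inner_diff_right right_minus_eq)
    with v show False by blast
  qed
  then show ?thesis by (rule that)
qed

lemma monotone_enumeration:
  fixes S :: "'a set" and h :: "'a \<Rightarrow> real"
  assumes "finite S" "inj_on h S"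
  obtains e where "e ` {..<card S} = S" "strict_mono_on {..<card S} (h \<circ> e)"
proof -
  define xs where "xs = sorted_list_of_set (h ` S)"
  define e where "e i = inv_into S h (xs ! i)" for i
  have len: "length xs = card S" and set: "set xs = h ` S"
    using assms by (auto simp: xs_def card_image)
  have he: "h (e i) = xs ! i" "e i \<in> S" if "i < card S" for i
  proof -
    have "xs ! i \<in> h ` S" using that len set nth_mem by metis
    then show "h (e i) = xs ! i" "e i \<in> S" by (auto simp: e_def f_inv_into_f inv_into_into)
  qed
  have mono: "strict_mono_on {..<card S} (h \<circ> e)"
  proof (rule strict_mono_onI)
    fix i j assume "i \<in> {..<card S}" "j \<in> {..<card S}" "i < j"
    then show "(h \<circ> e) i < (h \<circ> e) j"
      using he sorted_wrt_nth_less[of "(<)" xs i j] len by (simp add: xs_def)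
  qed
  then have "inj_on e {..<card S}"
    using strict_mono_on_imp_inj_on inj_on_imageI2 by blast
  then have "e ` {..<card S} = S"
    using he assms by (intro card_subset_eq) (auto simp: card_image)
  with mono show ?thesis by (rule that[rotated])
qed

text \<open>Ordering both sets by a functional that is injective on them makes the straight-line motion
  collision-free; this covers dimension one together with all others.\<close>

lemma homeomorphism_between_finite_sets:
  fixes S S' :: "'a::euclidean_space set"
  assumes "finite S" "finite S'" "card S = card S'"
  obtains f g where "homeo_family T (\<lambda>_::real. f) (\<lambda>_. g)" "f ` S = S'"
proof -
  obtain v where v: "inj_on ((\<bullet>) v) (S \<union> S')"
    using generic_functional assms by (metis finite_UnI)
  have vS: "inj_on ((\<bullet>) v) S" "inj_on ((\<bullet>) v) S'"
    using v by (auto intro: inj_on_subset)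
  define p where "p = card S"
  obtain e where e: "e ` {..<p} = S" "strict_mono_on {..<p} ((\<bullet>) v \<circ> e)"
    using monotone_enumeration[OF assms(1) vS(1)] by (auto simp: p_def)
  obtain e' where e': "e' ` {..<p} = S'" "strict_mono_on {..<p} ((\<bullet>) v \<circ> e')"
    using monotone_enumeration[OF assms(2) vS(2)] assms(3) by (auto simp: p_def)
  define q where "q t i = (1 - t) *\<^sub>R e i + t *\<^sub>R e' i" for t :: real and i
  have "inj_on (q t) {..<p}" if t: "t \<in> {0..1}" for t
  proof -
    have "strict_mono_on {..<p} ((\<bullet>) v \<circ> q t)"
    proof (rule strict_mono_onI)
      fix i j assume ij: "i \<in> {..<p}" "j \<in> {..<p}" "i < j"
      then have lt: "v \<bullet> e i < v \<bullet> e j" "v \<bullet> e' i < v \<bullet> e' j"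
        using e(2) e'(2) by (auto simp: strict_mono_on_def)
      have "(1 - t) * (v \<bullet> e i) + t * (v \<bullet> e' i) < (1 - t) * (v \<bullet> e j) + t * (v \<bullet> e' j)"
      proof (cases "t = 1")
        case False
        then have "(1 - t) * (v \<bullet> e i) < (1 - t) * (v \<bullet> e j)" using lt t by simp
        moreover have "t * (v \<bullet> e' i) \<le> t * (v \<bullet> e' j)" using lt t by (intro mult_left_mono) auto
        ultimately show ?thesis by linarith
      qed (use lt in auto)
      then show "((\<bullet>) v \<circ> q t) i < ((\<bullet>) v \<circ> q t) j"
        by (simp add: q_def inner_add_right)
    qed
    then show ?thesis using strict_mono_on_imp_inj_on inj_on_imageI2 by blast
  qed
  moreover have "continuous_on {0..1} (\<lambda>t. q t i)" for i
    unfolding q_def by (intro continuous_intros)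
  ultimately obtain \<Phi> \<Psi> where F: "homeo_family {0..1} \<Phi> \<Psi>"
    "\<And>t i. t \<in> {0..1} \<Longrightarrow> i \<in> {..<p} \<Longrightarrow> \<Phi> t (q 0 i) = q t i"
    using ambient_isotopy[of "{..<p}" q] by (metis finite_lessThan)
  have "\<Phi> 1 ` S = S'"
    using F(2)[of 1] by (force simp: e(1)[symmetric] e'(1)[symmetric] q_def image_image)
  moreover have "homeo_family T (\<lambda>_. \<Phi> 1) (\<lambda>_. \<Psi> 1)"
    by (rule homeo_family_const[OF F(1)]) auto
  ultimately show ?thesis using that by blast
qed

section \<open>Moving the obstacles\<close>

lemma continuous_map_Conf_iff:
  "continuous_map Z (Conf X n) a \<longleftrightarrow>
     (\<forall>z\<in>topspace Z. a z \<in> extensional {1..n} \<and> inj_on (a z) {1..n}) \<and>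
     (\<forall>i\<in>{1..n}. continuous_map Z X (\<lambda>z. a z i))"
  by (auto simp: Conf_def continuous_map_in_subtopology continuous_map_componentwise)

lemma Conf_complement:
  "Conf (top_of_set (UNIV - S)) n = subtopology (Conf euclidean n) {a. underlying_set n a \<inter> S = {}}"
proof (rule topology_eqI_continuous_map)
  show "continuous_map Z (Conf (top_of_set (UNIV - S)) n) f \<longleftrightarrow>
      continuous_map Z (subtopology (Conf euclidean n) {a. underlying_set n a \<inter> S = {}}) f"
    for Z :: "(nat \<Rightarrow> 'a) topology" and f
    by (simp add: continuous_map_in_subtopology continuous_map_Conf_iff underlying_set_def) blast
qed

text \<open>Together with \<open>B_space_const\<close>, this identifies the spaces for resting
  obstacles as equal topologies, so the evaluation map becomes literally the one in the definition
  of \<open>TC\<close>.\<close>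

lemma E_space_const:
  "E_space n p (\<lambda>_. c) = path_space (Conf (top_of_set (UNIV - underlying_set p c)) n)"
  by (simp add: E_space_def Conf_complement path_space_subtopology)

lemma B_space_const:
  "B_space n s p (\<lambda>_. c) =
     product_topology (\<lambda>_. Conf (top_of_set (UNIV - underlying_set p c)) n) {1..s}"
proof (rule topology_eqI_continuous_map)
  show "continuous_map Z (B_space n s p (\<lambda>_. c)) f \<longleftrightarrow>
      continuous_map Z (product_topology (\<lambda>_. Conf (top_of_set (UNIV - underlying_set p c)) n) {1..s}) f"
    for Z :: "(nat \<Rightarrow> nat \<Rightarrow> real ^ 'm) topology" and f
    by (simp add: B_space_def Conf_complement continuous_map_in_subtopology
          continuous_map_componentwise) blast
qed

lemma continuous_map_E_space_iff:
  "continuous_map Z (E_space n p Q) \<gamma> \<longleftrightarrow>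
     (\<forall>z\<in>topspace Z. \<gamma> z \<in> extensional {0..1} \<and>
        (\<forall>t\<in>{0..1}. \<gamma> z t \<in> extensional {1..n} \<and> inj_on (\<gamma> z t) {1..n} \<and>
           underlying_set n (\<gamma> z t) \<inter> underlying_set p (Q t) = {})) \<and>
     (\<forall>i\<in>{1..n}. continuous_map (prod_topology Z unit_interval) euclidean (\<lambda>(z, t). \<gamma> z t i))"
  by (simp add: E_space_def continuous_map_in_subtopology continuous_map_path_space_iff
        continuous_map_Conf_iff case_prod_unfold) fastforce

lemma continuous_map_B_space_iff:
  "continuous_map Z (B_space n s p Q) A \<longleftrightarrow>
     (\<forall>z\<in>topspace Z. A z \<in> extensional {1..s} \<and>
        (\<forall>j\<in>{1..s}. A z j \<in> extensional {1..n} \<and> inj_on (A z j) {1..n} \<and>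
           underlying_set n (A z j) \<inter> underlying_set p (Q (sample_time s j)) = {})) \<and>
     (\<forall>j\<in>{1..s}. \<forall>i\<in>{1..n}. continuous_map Z euclidean (\<lambda>z. A z j i))"
  by (simp add: B_space_def continuous_map_in_subtopology continuous_map_componentwise
        continuous_map_Conf_iff sample_time_def) fastforce

text \<open>The identity map, put into the two criteria, yields the properties of the points
  together with the continuity of evaluation and of coordinates.\<close>

lemmas E_space_points = iffD1[OF continuous_map_E_space_iff continuous_map_id[unfolded id_def]]
lemmas B_space_points = iffD1[OF continuous_map_B_space_iff continuous_map_id[unfolded id_def]]

lemma eval_map_in_B_space:
  assumes "s \<ge> 2" "\<gamma> \<in> topspace (E_space n p Q)"
  shows "eval_map s \<gamma> \<in> topspace (B_space n s p Q)"
proof -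
  have "\<gamma> t \<in> topspace (Conf euclidean n)" "underlying_set n (\<gamma> t) \<inter> underlying_set p (Q t) = {}"
    if "t \<in> {0..1}" for t
    using assms(2) that
    by (auto simp: E_space_def topspace_path_space mapping_space_def continuous_map_def)
  then show ?thesis
    using sample_time_in_unit[OF assms(1)]
    by (auto simp: B_space_def eval_map_alt simp flip: sample_time_def)
qed

text \<open>Both restrictions are there to keep the result extensional in time and in the index, as
  membership in the path space of configurations demands.\<close>

definition move_path :: "nat \<Rightarrow> (real \<Rightarrow> 'a \<Rightarrow> 'a) \<Rightarrow> (real \<Rightarrow> nat \<Rightarrow> 'a) \<Rightarrow> (real \<Rightarrow> nat \<Rightarrow> 'a)" where
  "move_path n \<Phi> \<gamma> = (\<lambda>t\<in>{0..1}. \<lambda>i\<in>{1..n}. \<Phi> t (\<gamma> t i))"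

definition move_configs :: "nat \<Rightarrow> nat \<Rightarrow> (real \<Rightarrow> 'a \<Rightarrow> 'a) \<Rightarrow> (nat \<Rightarrow> nat \<Rightarrow> 'a) \<Rightarrow> (nat \<Rightarrow> nat \<Rightarrow> 'a)" where
  "move_configs n s \<Phi> A = (\<lambda>j\<in>{1..s}. \<lambda>i\<in>{1..n}. \<Phi> (sample_time s j) (A j i))"

lemma eval_map_move_path:
  assumes "s \<ge> 2"
  shows "eval_map s (move_path n \<Phi> \<gamma>) = move_configs n s \<Phi> (eval_map s \<gamma>)"
  using sample_time_in_unit[OF assms]
  by (auto simp: eval_map_alt move_path_def move_configs_def intro!: restrict_ext)

lemma homeo_family_inj: "homeo_family S \<Phi> \<Psi> \<Longrightarrow> t \<in> S \<Longrightarrow> inj (\<Phi> t)"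
  unfolding homeo_family_def by (metis injI)

lemma moved_tuple:
  assumes "homeo_family S \<Phi> \<Psi>" "t \<in> S" "\<Phi> t ` underlying_set p q = underlying_set p q'"
    and "inj_on a {1..n}" "underlying_set n a \<inter> underlying_set p q = {}"
  shows "inj_on (\<lambda>i\<in>{1..n}. \<Phi> t (a i)) {1..n}"
    and "underlying_set n (\<lambda>i\<in>{1..n}. \<Phi> t (a i)) \<inter> underlying_set p q' = {}"
proof -
  note inj = homeo_family_inj[OF assms(1,2)]
  show "inj_on (\<lambda>i\<in>{1..n}. \<Phi> t (a i)) {1..n}"
    by (rule inj_onI) (metis assms(4) inj inj_onD injD restrict_apply')
  have "underlying_set n (\<lambda>i\<in>{1..n}. \<Phi> t (a i)) = \<Phi> t ` underlying_set n a"
    by (simp add: underlying_set_def image_image)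
  then show "underlying_set n (\<lambda>i\<in>{1..n}. \<Phi> t (a i)) \<inter> underlying_set p q' = {}"
    using image_Int[OF inj, of "underlying_set n a" "underlying_set p q"] by (simp only: assms(3,5) image_empty)
qed

lemma continuous_map_family:
  fixes f :: "'z \<Rightarrow> 'a::topological_space"
  assumes "homeo_family {0..1} \<Phi> \<Psi>"
    and "continuous_map Z unit_interval \<tau>" "continuous_map Z euclidean f"
  shows "continuous_map Z euclidean (\<lambda>z. \<Phi> (\<tau> z) (f z))"
proof -
  have "continuous_map Z (prod_topology unit_interval euclidean) (\<lambda>z. (\<tau> z, f z))"
    using assms(2,3) by (simp add: continuous_map_pairwise o_def)
  moreover have "prod_topology unit_interval (euclidean :: 'a topology) = top_of_set ({0..1} \<times> UNIV)"
    using subtopology_Times[of euclidean "euclidean :: 'a topology" "{0..1::real}" UNIV] by simp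
  moreover have "continuous_map (top_of_set ({0..1} \<times> UNIV)) euclidean (\<lambda>(t, x). \<Phi> t x)"
    using assms(1) by (simp add: homeo_family_def)
  ultimately have "continuous_map Z euclidean ((\<lambda>(t, x). \<Phi> t x) \<circ> (\<lambda>z. (\<tau> z, f z)))"
    by (metis continuous_map_compose)
  then show ?thesis by (simp add: o_def)
qed

text \<open>In each coordinate the adjoint is the jointly continuous evaluation of a path at a time
  followed by the jointly continuous family \<Phi>; injectivity of each \<open>\<Phi> t\<close>
  keeps points apart and off the moved obstacles.\<close>

lemma continuous_map_move_path:
  assumes \<Phi>: "homeo_family {0..1} \<Phi> \<Psi>"
    and img: "\<And>t. t \<in> {0..1} \<Longrightarrow> \<Phi> t ` underlying_set p (Q t) = underlying_set p (Q' t)"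
  shows "continuous_map (E_space n p Q) (E_space n p Q') (move_path n \<Phi>)"
  unfolding continuous_map_E_space_iff
proof (intro conjI ballI)
  fix i assume i: "i \<in> {1..n}"
  let ?P = "prod_topology (E_space n p Q) unit_interval"
  have "continuous_map ?P euclidean (\<lambda>x. \<Phi> (snd x) (fst x (snd x) i))"
    using E_space_points[of n p Q] i
    by (intro continuous_map_family[OF \<Phi>] continuous_map_snd) (auto simp: case_prod_unfold)
  then show "continuous_map ?P euclidean (\<lambda>(\<gamma>, t). move_path n \<Phi> \<gamma> t i)"
    by (rule continuous_map_eq) (use i in \<open>auto simp: move_path_def\<close>)
next
  fix \<gamma> t assume \<gamma>: "\<gamma> \<in> topspace (E_space n p Q)" and t: "t \<in> {0..1::real}"
  have "inj_on (\<gamma> t) {1..n}" "underlying_set n (\<gamma> t) \<inter> underlying_set p (Q t) = {}"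
    using E_space_points[of n p Q] \<gamma> t by auto
  from moved_tuple[OF \<Phi> t img[OF t] this]
  show "inj_on (move_path n \<Phi> \<gamma> t) {1..n}"
    "underlying_set n (move_path n \<Phi> \<gamma> t) \<inter> underlying_set p (Q' t) = {}"
    using t by (simp_all add: move_path_def)
qed (auto simp: move_path_def)

lemma continuous_map_move_configs:
  assumes s: "s \<ge> 2" and \<Phi>: "homeo_family {0..1} \<Phi> \<Psi>"
    and img: "\<And>t. t \<in> {0..1} \<Longrightarrow> \<Phi> t ` underlying_set p (Q t) = underlying_set p (Q' t)"
  shows "continuous_map (B_space n s p Q) (B_space n s p Q') (move_configs n s \<Phi>)"
  unfolding continuous_map_B_space_iff
proof (intro conjI ballI)
  fix j i assume j: "j \<in> {1..s}" and i: "i \<in> {1..n}"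
  have "continuous_map (B_space n s p Q) euclidean (\<lambda>A. \<Phi> (sample_time s j) (A j i))"
    using B_space_points[of n s p Q] i j sample_time_in_unit[OF s j]
    by (intro continuous_map_family[OF \<Phi>]) auto
  then show "continuous_map (B_space n s p Q) euclidean (\<lambda>A. move_configs n s \<Phi> A j i)"
    using i j by (simp add: move_configs_def)
next
  fix A j assume A: "A \<in> topspace (B_space n s p Q)" and j: "j \<in> {1..s}"
  note t = sample_time_in_unit[OF s j]
  have "inj_on (A j) {1..n}" "underlying_set n (A j) \<inter> underlying_set p (Q (sample_time s j)) = {}"
    using B_space_points[of n s p Q] A j by auto
  from moved_tuple[OF \<Phi> t img[OF t] this]
  show "inj_on (move_configs n s \<Phi> A j) {1..n}"
    "underlying_set n (move_configs n s \<Phi> A j) \<inter> underlying_set p (Q' (sample_time s j)) = {}"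
    using j by (simp_all add: move_configs_def)
qed (auto simp: move_configs_def)

lemma homeo_family_image_inverse:
  assumes "homeo_family S \<Phi> \<Psi>" "t \<in> S" "\<Phi> t ` A = B"
  shows "\<Psi> t ` B = A"
  using assms by (force simp: homeo_family_def image_image)

lemma homeomorphic_maps_move:
  assumes s: "s \<ge> 2" and \<Phi>: "homeo_family {0..1} \<Phi> \<Psi>"
    and img: "\<And>t. t \<in> {0..1} \<Longrightarrow> \<Phi> t ` underlying_set p (Q t) = underlying_set p (Q' t)"
  shows "homeomorphic_maps (E_space n p Q) (E_space n p Q') (move_path n \<Phi>) (move_path n \<Psi>)"
    and "homeomorphic_maps (B_space n s p Q) (B_space n s p Q') (move_configs n s \<Phi>) (move_configs n s \<Psi>)"
proof -
  note \<Psi> = homeo_family_inverse[OF \<Phi>]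
  have img': "\<Psi> t ` underlying_set p (Q' t) = underlying_set p (Q t)" if "t \<in> {0..1}" for t
    using homeo_family_image_inverse[OF \<Phi> that img[OF that]] .
  \<comment> \<open>Stated for arbitrary families and obstacles, so that it serves for both
    compositions, with \<Phi> and \<Psi> exchanged.\<close>
  have path: "move_path n \<Psi> (move_path n \<Phi> \<gamma>) = \<gamma>"
    if "homeo_family {0..1} \<Phi> \<Psi>" "\<gamma> \<in> topspace (E_space n p Q)" for \<Phi> \<Psi> \<gamma> Q
  proof (rule extensionalityI)
    show "\<gamma> \<in> extensional {0..1}" using E_space_points[of n p Q] that(2) by blast
    fix t assume t: "t \<in> {0..1::real}"
    show "move_path n \<Psi> (move_path n \<Phi> \<gamma>) t = \<gamma> t"
    proof (rule extensionalityI)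
      show "\<gamma> t \<in> extensional {1..n}" using E_space_points[of n p Q] that(2) t by blast
    qed (use t that(1) in \<open>auto simp: move_path_def homeo_family_def\<close>)
  qed (auto simp: move_path_def)
  have configs: "move_configs n s \<Psi> (move_configs n s \<Phi> A) = A"
    if "homeo_family {0..1} \<Phi> \<Psi>" "A \<in> topspace (B_space n s p Q)" for \<Phi> \<Psi> A Q
  proof (rule extensionalityI)
    show "A \<in> extensional {1..s}" using B_space_points[of n s p Q] that(2) by blast
    fix j assume j: "j \<in> {1..s}"
    show "move_configs n s \<Psi> (move_configs n s \<Phi> A) j = A j"
    proof (rule extensionalityI)
      show "A j \<in> extensional {1..n}" using B_space_points[of n s p Q] that(2) j by blast
    qed (use j that(1) sample_time_in_unit[OF s j] in \<open>auto simp: move_configs_def homeo_family_def\<close>)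
  qed (auto simp: move_configs_def)
  show "homeomorphic_maps (E_space n p Q) (E_space n p Q') (move_path n \<Phi>) (move_path n \<Psi>)"
    unfolding homeomorphic_maps_def
    using continuous_map_move_path[OF \<Phi> img] continuous_map_move_path[OF \<Psi> img'] path[OF \<Phi>] path[OF \<Psi>]
    by blast
  show "homeomorphic_maps (B_space n s p Q) (B_space n s p Q') (move_configs n s \<Phi>) (move_configs n s \<Psi>)"
    unfolding homeomorphic_maps_def
    using continuous_map_move_configs[OF s \<Phi> img] continuous_map_move_configs[OF s \<Psi> img']
      configs[OF \<Phi>] configs[OF \<Psi>]
    by blast
qed

text \<open>At time \<open>t\<close>, rewind the first obstacles to their start, match the two
  starting sets by \<open>f\<close>, then follow the second obstacles forward to time
  \<open>t\<close>.\<close>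

lemma obstacle_matching_family:
  fixes Q Q' :: "real \<Rightarrow> nat \<Rightarrow> 'a::euclidean_space"
  assumes "continuous_map unit_interval (Conf euclidean p) Q"
    and "continuous_map unit_interval (Conf euclidean p) Q'"
  obtains \<Phi> \<Psi> where "homeo_family {0..1} \<Phi> \<Psi>"
    "\<And>t. t \<in> {0..1} \<Longrightarrow> \<Phi> t ` underlying_set p (Q t) = underlying_set p (Q' t)"
proof -
  have track: "\<exists>\<Phi> \<Psi>. homeo_family {0..1} \<Phi> \<Psi> \<and>
      (\<forall>t\<in>{0..1}. \<Phi> t ` underlying_set p (R 0) = underlying_set p (R t))"
    if "continuous_map unit_interval (Conf euclidean p) R" for R :: "real \<Rightarrow> nat \<Rightarrow> 'a"
  proof -
    have cont: "\<And>i. i \<in> {1..p} \<Longrightarrow> continuous_on {0..1} (\<lambda>t. R t i)"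
      and inj: "\<And>t. t \<in> {0..1} \<Longrightarrow> inj_on (R t) {1..p}"
      using that by (auto simp: continuous_map_Conf_iff)
    obtain \<Phi> \<Psi> where 1: "homeo_family {0..1} \<Phi> \<Psi>"
      and 2: "\<And>t i. t \<in> {0..1} \<Longrightarrow> i \<in> {1..p} \<Longrightarrow> \<Phi> t (R 0 i) = R t i"
      using ambient_isotopy[OF finite_atLeastAtMost cont inj] by blast
    then have "\<forall>t\<in>{0..1}. \<Phi> t ` underlying_set p (R 0) = underlying_set p (R t)"
      by (auto simp: underlying_set_def image_image)
    with 1 show ?thesis by blast
  qed
  obtain \<Phi>1 \<Psi>1 where 1: "homeo_family {0..1} \<Phi>1 \<Psi>1"
    "\<And>t. t \<in> {0..1} \<Longrightarrow> \<Phi>1 t ` underlying_set p (Q 0) = underlying_set p (Q t)"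
    using track[OF assms(1)] by blast
  obtain \<Phi>2 \<Psi>2 where 2: "homeo_family {0..1} \<Phi>2 \<Psi>2"
    "\<And>t. t \<in> {0..1} \<Longrightarrow> \<Phi>2 t ` underlying_set p (Q' 0) = underlying_set p (Q' t)"
    using track[OF assms(2)] by blast
  have "card (underlying_set p R) = p" if "inj_on R {1..p}" for R :: "nat \<Rightarrow> 'a"
    using card_image[OF that] by (simp add: underlying_set_def)
  then have "card (underlying_set p (Q 0)) = card (underlying_set p (Q' 0))"
    using assms by (simp add: continuous_map_Conf_iff)
  then obtain f g where 3: "homeo_family {0..1::real} (\<lambda>_. f) (\<lambda>_. g)"
    "f ` underlying_set p (Q 0) = underlying_set p (Q' 0)"
    using homeomorphism_between_finite_sets[of "underlying_set p (Q 0)" "underlying_set p (Q' 0)"]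
    by (metis finite_atLeastAtMost finite_imageI underlying_set_def)
  show ?thesis
  proof
    show "homeo_family {0..1} (\<lambda>t x. \<Phi>2 t (f (\<Psi>1 t x))) (\<lambda>t x. \<Phi>1 t (g (\<Psi>2 t x)))"
      using homeo_family_comp[OF homeo_family_comp[OF 2(1) 3(1)] homeo_family_inverse[OF 1(1)]] .
    fix t :: real assume t: "t \<in> {0..1}"
    have "(\<lambda>x. \<Phi>2 t (f (\<Psi>1 t x))) ` underlying_set p (Q t) = \<Phi>2 t ` f ` \<Psi>1 t ` underlying_set p (Q t)"
      by (simp add: image_image)
    then show "(\<lambda>x. \<Phi>2 t (f (\<Psi>1 t x))) ` underlying_set p (Q t) = underlying_set p (Q' t)"
      using homeo_family_image_inverse[OF 1(1) t 1(2)[OF t]] 3(2) 2(2)[OF t] by simp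
  qed
qed

section \<open>Invariance of the lifting property and of sectional category\<close>

text \<open>A lifting problem is pushed forward by \<open>h\<close> and \<open>k\<close>, solved
  there, and its solution pulled back by \<open>h'\<close>. Applying \<open>k\<close> to the
  required equation gives the solved one, and \<open>k\<close> is injective on the points of
  \<open>B'\<close>.\<close>

lemma fibration_transport:
  assumes fib: "fibration TYPE('z) E B \<pi>"
    and h: "homeomorphic_maps E' E h h'" and k: "homeomorphic_maps B' B k k'"
    and comm: "\<And>e. e \<in> topspace E' \<Longrightarrow> \<pi> (h e) = k (\<pi>' e)"
    and \<pi>': "\<And>e. e \<in> topspace E' \<Longrightarrow> \<pi>' e \<in> topspace B'"
  shows "fibration TYPE('z) E' B' \<pi>'"
  unfolding fibration_def
proof (intro conjI allI impI)
  have ch: "continuous_map E' E h" "continuous_map E E' h'" and hh: "\<And>e. e \<in> topspace E' \<Longrightarrow> h' (h e) = e"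
      "\<And>e. e \<in> topspace E \<Longrightarrow> h (h' e) = e"
    and ck: "continuous_map B' B k" "continuous_map B B' k'" and kk: "\<And>b. b \<in> topspace B' \<Longrightarrow> k' (k b) = b"
    using h k by (auto simp: homeomorphic_maps_def)
  have c\<pi>: "continuous_map E B \<pi>" using fib by (simp add: fibration_def)
  show "continuous_map E' B' \<pi>'"
    by (rule continuous_map_eq[OF continuous_map_compose[OF continuous_map_compose[OF ch(1) c\<pi>] ck(2)]])
      (simp add: comm \<pi>' kk)
  fix Z :: "'z topology" and f H
  assume asm: "continuous_map Z E' f \<and> continuous_map (prod_topology Z unit_interval) B' H \<and>
    (\<forall>z\<in>topspace Z. H (z, 0) = \<pi>' (f z))"
  have fE: "f z \<in> topspace E'" if "z \<in> topspace Z" for z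
    using asm that by (auto simp: continuous_map_def)
  have "continuous_map Z E (h \<circ> f)" "continuous_map (prod_topology Z unit_interval) B (k \<circ> H)"
    using asm ch(1) ck(1) by (auto intro: continuous_map_compose)
  moreover have "\<forall>z\<in>topspace Z. (k \<circ> H) (z, 0) = \<pi> ((h \<circ> f) z)"
    using asm comm fE by simp
  ultimately obtain G where G: "continuous_map (prod_topology Z unit_interval) E G"
    "\<And>z. z \<in> topspace Z \<Longrightarrow> G (z, 0) = h (f z)"
    "\<And>z t. z \<in> topspace Z \<Longrightarrow> t \<in> {0..1} \<Longrightarrow> \<pi> (G (z, t)) = k (H (z, t))"
    using fib[unfolded fibration_def, THEN conjunct2, rule_format, of Z "h \<circ> f" "k \<circ> H"] by auto
  have "\<pi>' (h' (G (z, t))) = H (z, t)" if "z \<in> topspace Z" "t \<in> {0..1}" for z t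
  proof -
    have g: "G (z, t) \<in> topspace E" and H: "H (z, t) \<in> topspace B'"
      using G(1) asm that by (auto simp: continuous_map_def Pi_iff)
    have e: "h' (G (z, t)) \<in> topspace E'" using g ch(2) by (auto simp: continuous_map_def)
    have "k (\<pi>' (h' (G (z, t)))) = k (H (z, t))"
      using comm[OF e] hh(2)[OF g] G(3)[OF that] by simp
    then show ?thesis using kk \<pi>'[OF e] H by metis
  qed
  then show "\<exists>G. continuous_map (prod_topology Z unit_interval) E' G \<and>
             (\<forall>z\<in>topspace Z. G (z, 0) = f z) \<and>
             (\<forall>z\<in>topspace Z. \<forall>t\<in>{0..1}. \<pi>' (G (z, t)) = H (z, t))"
    using continuous_map_compose[OF G(1) ch(2)] G(2) hh(1) fE
    by (intro exI[of _ "h' \<circ> G"]) auto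
qed

text \<open>A local section \<sigma> over \<open>U\<close> becomes h \<circ> \<sigma> \<circ> k'
  over the preimage of \<open>U\<close> under \<open>k'\<close>, and these preimages cover
  \<open>B'\<close>. So every length admissible for \<pi> is admissible for \<pi>', and the larger
  set has the smaller infimum.\<close>

lemma secat_le:
  assumes h: "continuous_map E E' h" and k: "homeomorphic_maps B B' k k'"
    and comm: "\<And>e. e \<in> topspace E \<Longrightarrow> \<pi>' (h e) = k (\<pi> e)"
  shows "secat E' B' \<pi>' \<le> secat E B \<pi>"
  unfolding secat_def
proof (rule Inf_superset_mono, safe)
  fix l :: nat and U
  assume U: "\<forall>j\<le>l. openin B (U j) \<and> has_section_on E B \<pi> (U j)" and cover: "(\<Union>j\<le>l. U j) = topspace B"
  have k': "homeomorphic_maps B' B k' k" using k by (rule homeomorphic_maps_sym[THEN iffD1])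
  then have ck': "continuous_map B' B k'" and kk: "\<And>b. b \<in> topspace B' \<Longrightarrow> k (k' b) = b"
    by (auto simp: homeomorphic_maps_def)
  define V where "V j = {b \<in> topspace B'. k' b \<in> U j}" for j
  have "openin B' (V j)" if "j \<le> l" for j
    unfolding V_def using ck' U that by (intro openin_continuous_map_preimage) auto
  moreover have "has_section_on E' B' \<pi>' (V j)" if j: "j \<le> l" for j
  proof -
    obtain \<sigma> where \<sigma>: "continuous_map (subtopology B (U j)) E \<sigma>" "\<forall>b\<in>topspace B \<inter> U j. \<pi> (\<sigma> b) = b"
      using U j by (auto simp: has_section_on_def)
    have "continuous_map (subtopology B' (V j)) (subtopology B (U j)) k'"
      using ck' by (auto simp: continuous_map_in_subtopology V_def intro: continuous_map_from_subtopology)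
    from continuous_map_compose[OF continuous_map_compose[OF this \<sigma>(1)] h]
    have "continuous_map (subtopology B' (V j)) E' (h \<circ> (\<sigma> \<circ> k'))" .
    moreover have "\<pi>' ((h \<circ> (\<sigma> \<circ> k')) b) = b" if "b \<in> topspace B' \<inter> V j" for b
    proof -
      have b: "k' b \<in> topspace B \<inter> U j"
        using that ck' by (auto simp: V_def continuous_map_def)
      then have "\<sigma> (k' b) \<in> topspace E"
        using \<sigma>(1) by (auto simp: continuous_map_def)
      then show ?thesis using comm \<sigma>(2) b kk that by simp
    qed
    ultimately show ?thesis unfolding has_section_on_def by blast
  qed
  moreover have "(\<Union>j\<le>l. V j) = topspace B'"
  proof
    show "topspace B' \<subseteq> (\<Union>j\<le>l. V j)"
      using ck' cover unfolding V_def continuous_map_def by fastforce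
  qed (auto simp: V_def)
  ultimately show "\<exists>l'. enat l = enat l' \<and> (\<exists>U. (\<forall>j\<le>l'. openin B' (U j) \<and> has_section_on E' B' \<pi>' (U j)) \<and>
      (\<Union>j\<le>l'. U j) = topspace B')"
    by blast
qed

lemma secat_cong:
  assumes h: "homeomorphic_maps E E' h h'" and k: "homeomorphic_maps B B' k k'"
    and comm: "\<And>e. e \<in> topspace E \<Longrightarrow> \<pi>' (h e) = k (\<pi> e)"
    and \<pi>: "\<And>e. e \<in> topspace E \<Longrightarrow> \<pi> e \<in> topspace B"
  shows "secat E B \<pi> = secat E' B' \<pi>'"
proof (rule order_antisym)
  show "secat E' B' \<pi>' \<le> secat E B \<pi>"
    using h comm by (intro secat_le[OF _ k]) (auto simp: homeomorphic_maps_def)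
  \<comment> \<open>The inverse homeomorphisms intertwine the projections too, so the one-sided
    estimate applies in the opposite direction.\<close>
  have "\<pi> (h' e) = k' (\<pi>' e)" if "e \<in> topspace E'" for e
  proof -
    have e: "h' e \<in> topspace E" "h (h' e) = e"
      using h that by (auto simp: homeomorphic_maps_def continuous_map_def)
    then have "k' (k (\<pi> (h' e))) = \<pi> (h' e)"
      using k \<pi> by (auto simp: homeomorphic_maps_def)
    with comm[OF e(1)] e(2) show ?thesis by simp
  qed
  moreover have "continuous_map E' E h'" "homeomorphic_maps B' B k' k"
    using h k by (auto simp: homeomorphic_maps_def)
  ultimately show "secat E B \<pi> \<le> secat E' B' \<pi>'"
    using secat_le by metis
qed

theorem theorem1p2:
  fixes Q :: "real \<Rightarrow> nat \<Rightarrow> real ^ 'm"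
    and n p s :: nat
  assumes "n \<ge> 1" and "s \<ge> 2"
    and "continuous_map unit_interval (Conf euclidean p) Q"
  shows "fibration TYPE('z) (E_space n p Q) (B_space n s p Q) (eval_map s)
    \<and> (\<forall>Q' :: real \<Rightarrow> nat \<Rightarrow> real ^ 'm.
         continuous_map unit_interval (Conf euclidean p) Q' \<longrightarrow>
         (\<exists>h k. homeomorphic_map (E_space n p Q) (E_space n p Q') h
              \<and> homeomorphic_map (B_space n s p Q) (B_space n s p Q') k
              \<and> (\<forall>\<gamma> \<in> topspace (E_space n p Q). eval_map s (h \<gamma>) = k (eval_map s \<gamma>))))
    \<and> secat (E_space n p Q) (B_space n s p Q) (eval_map s)
        = TC s (Conf (top_of_set (UNIV - underlying_set p (Q 0))) n)"
proof -
  let ?Q0 = "\<lambda>_. Q 0"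
  let ?X = "Conf (top_of_set (UNIV - underlying_set p (Q 0))) n"
  have "continuous_map unit_interval (Conf euclidean p) ?Q0"
    using assms(3) by (auto simp: continuous_map_def)
  with assms(3) obtain \<Phi> \<Psi> where \<Phi>: "homeo_family {0..1} \<Phi> \<Psi>"
    "\<And>t. t \<in> {0..1} \<Longrightarrow> \<Phi> t ` underlying_set p (Q t) = underlying_set p (?Q0 t)"
    by (rule obstacle_matching_family) blast
  note iso = homeomorphic_maps_move[OF assms(2) \<Phi>, of n]
  have iso0: "homeomorphic_maps (E_space n p Q) (path_space ?X) (move_path n \<Phi>) (move_path n \<Psi>)"
    "homeomorphic_maps (B_space n s p Q) (product_topology (\<lambda>_. ?X) {1..s})
       (move_configs n s \<Phi>) (move_configs n s \<Psi>)"
    using iso by (simp_all only: E_space_const B_space_const)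
  show ?thesis
  proof (intro conjI allI impI)
    show "fibration TYPE('z) (E_space n p Q) (B_space n s p Q) (eval_map s)"
      by (rule fibration_transport[OF fibration_eval_map[OF assms(2)] iso0])
        (simp_all add: eval_map_move_path eval_map_in_B_space assms(2))
    show "secat (E_space n p Q) (B_space n s p Q) (eval_map s) = TC s ?X"
      unfolding TC_def
      by (rule secat_cong[OF iso0]) (simp_all add: eval_map_move_path eval_map_in_B_space assms(2))
    fix Q' :: "real \<Rightarrow> nat \<Rightarrow> real ^ 'm"
    assume "continuous_map unit_interval (Conf euclidean p) Q'"
    with assms(3) obtain \<Phi>' \<Psi>' where \<Phi>': "homeo_family {0..1} \<Phi>' \<Psi>'"
      "\<And>t. t \<in> {0..1} \<Longrightarrow> \<Phi>' t ` underlying_set p (Q t) = underlying_set p (Q' t)"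
      by (rule obstacle_matching_family) blast
    show "\<exists>h k. homeomorphic_map (E_space n p Q) (E_space n p Q') h
        \<and> homeomorphic_map (B_space n s p Q) (B_space n s p Q') k
        \<and> (\<forall>\<gamma> \<in> topspace (E_space n p Q). eval_map s (h \<gamma>) = k (eval_map s \<gamma>))"
      using homeomorphic_maps_move[OF assms(2) \<Phi>'] eval_map_move_path[OF assms(2)]
      unfolding homeomorphic_map_maps by blast
  qed
qed

end
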